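(* Let $\mathcal S$ be a standard class, let $(X_0,X_1)$ be an admissible couple of K\"othe function spaces, fix $0<\theta<1$, and let $\Omega_\theta$ be the induced centralizer on $X_\theta=(X_0,X_1)_\theta$. If $(x_i)_{i=1}^n\in\mathcal S$ is an $n$-tuple in the unit ball of $X_\theta$, then $$\left\|\Omega_\theta\Big(\sum_{i=1}^nx_i\Big)-\sum_{i=1}^n\Omega_\theta(x_i)-\log\frac{M_{X_0,\mathcal S}(n)}{M_{X_1,\mathcal S}(n)}\Big(\sum_{i=1}^nx_i\Big)\right\|_{X_\theta}\le 3\,\frac{M_{X_0,\mathcal S}(n)^{1-\theta}M_{X_1,\mathcal S}(n)^{\theta}}{\mathrm{dist}(\theta,\partial\mathbb S)}.$$
   Context: Scalars are complex. A K\"othe function space $X$ over a ($\sigma$-finite) measure space is a Banach space of classes of measurable functions, contained in the space $L_0$ of all measurable functions, such that $|f|\le|g|$, $f\in L_0$, $g\in X$ imply $f\in X$, $\|f\|\le\|g\|$. Spaces with a $1$-unconditional basis are regarded as K\"othe function spaces on $\mathbb N$. A standard class $\mathcal S$ is a class of finite families ($n$-tuples) of elements of K\"othe function spaces (respectively, of spaces with $1$-unconditional bases) $X$ such that: (i) whenever $(x_i)\in\mathcal S$ and $\mathrm{supp}\,z_i\subset\mathrm{supp}\,x_i$ for all $i$, then $(z_i)\in\mathcal S$ (also when the $z_i$ lie in another space of the scale); (ii) if $W$ is a subspace of $X$ generated by disjoint vectors (respectively, by successive vectors) and $(x_i)$ is an $n$-tuple of elements of $W$ which belongs to $\mathcal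 S$ as a family in $W$, then it also belongs to $\mathcal S$ as a family in $X$. For a space $X$, $M_{X,\mathcal S}(n)=\sup\{\|x_1+\dots+x_n\|:(x_j)_{j=1}^n\in\mathcal S,\ x_j\in X,\ \|x_j\|\le1\}$. Complex interpolation: $\mathbb S=\{z\in\mathbb C:0\le\mathrm{Re}\,z\le1\}$ with boundary $\partial\mathbb S$, so $\mathrm{dist}(\theta,\partial\mathbb S)=\min(\theta,1-\theta)$; $\Sigma=X_0+X_1$; $\mathcal H$ is the Banach space of functions $g:\mathbb S\to\Sigma$ which are $\Sigma$-bounded, $\Sigma$-continuous on $\mathbb S$, analytic in the interior, with $t\mapsto g(j+it)\in X_j$ bounded and continuous for $j=0,1$, normed by $\sup\{\|g(j+it)\|_{X_j}\}$. $X_\theta=\{g(\theta):g\in\mathcal H\}$ with the quotient norm. The induced centralizer is $\Omega_\theta(x)=B_\theta(x)'(\theta)\in L_0$, where $B_\theta:X_\theta\to\mathcal H$ is a homogeneous map with $B_\theta(x)(\theta)=x$, $\|B_\theta(x)\|_{\mathcal H}\le(1+\epsilon)\|x\|$ for some fixed $0<\epsilon<1/4$, and $\mathrm{supp}\,B_\theta(x)(z)\subset\mathrm{supp}\,x$ for all $x$ and $z$. *)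

theory Defs
  imports "HOL-Analysis.Analysis"
begin

section \<open>Koethe function spaces\<close>

text \<open>
  A space of (classes of) measurable functions is given by its measure space, the set of all
  representatives of its elements, and its norm. Equality of elements is equality almost everywhere;
  the norm is only meaningful on elements.
\<close>

record 'a fspace =
  meas :: "'a measure"
  elts :: "('a \<Rightarrow> complex) set"
  nrm :: "('a \<Rightarrow> complex) \<Rightarrow> real"

definition kothe :: "'a fspace \<Rightarrow> bool" where
  "kothe X \<longleftrightarrow>
     sigma_finite_measure (meas X) \<and>
     elts X \<subseteq> borel_measurable (meas X) \<and>
     (\<lambda>_. 0) \<in> elts X \<and>
     (\<forall>f\<in>elts X. \<forall>g\<in>elts X. (\<lambda>t. f t + g t) \<in> elts X \<and>
        nrm X (\<lambda>t. f t + g t) \<le> nrm X f + nrm X g) \<and>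
     (\<forall>c. \<forall>f\<in>elts X. (\<lambda>t. c * f t) \<in> elts X \<and> nrm X (\<lambda>t. c * f t) = cmod c * nrm X f) \<and>
     (\<forall>f\<in>elts X. 0 \<le> nrm X f \<and> (nrm X f = 0 \<longleftrightarrow> (AE t in meas X. f t = 0))) \<and>
     (\<forall>f\<in>borel_measurable (meas X). \<forall>g\<in>elts X. (AE t in meas X. cmod (f t) \<le> cmod (g t)) \<longrightarrow>
        f \<in> elts X \<and> nrm X f \<le> nrm X g) \<and>
     (\<forall>F. (\<forall>k. F k \<in> elts X) \<and>
          (\<forall>e>0. \<exists>K. \<forall>m\<ge>K. \<forall>k\<ge>K. nrm X (\<lambda>t. F m t - F k t) < e) \<longrightarrow>
        (\<exists>f\<in>elts X. (\<lambda>k. nrm X (\<lambda>t. F k t - f t)) \<longlonglongrightarrow> 0))"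

text \<open>
  The ambient Hausdorff topological vector space of a couple is L0 with convergence in measure on sets
  of finite measure. Koethe function spaces always embed continuously into it (their norms are
  complete lattice norms), so no continuity requirement is listed.
\<close>

definition admissible_couple :: "'a fspace \<Rightarrow> 'a fspace \<Rightarrow> bool" where
  "admissible_couple X0 X1 \<longleftrightarrow> kothe X0 \<and> kothe X1 \<and> meas X0 = meas X1"

text \<open>
  A space with a 1-unconditional basis, as a Koethe function space on the natural numbers: the basis
  consists of the unit vectors lying in the space, which are those with index in an initial segment of
  the natural numbers (all of them, unless the space has finite dimension).
\<close>

definition basis_space :: "nat fspace \<Rightarrow> bool" where
  "basis_space X \<longleftrightarrow>
     kothe X \<and> meas X = count_space UNIV \<and>
     (\<forall>k. \<forall>j\<le>k. (indicator {k} :: nat \<Rightarrow> complex) \<in> elts X \<longrightarrow> indicator {j} \<in> elts X) \<and>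
     (\<forall>a\<in>elts X. (\<lambda>N. nrm X (\<lambda>k. a k - (if k < N then a k else 0))) \<longlonglongrightarrow> 0)"


section \<open>Standard classes\<close>

text \<open>
  A class of finite families, each taken together with the space whose elements it consists of.
\<close>

type_synonym 'a families = "('a fspace \<times> ('a \<Rightarrow> complex) list) set"

definition supp_le :: "'a measure \<Rightarrow> ('a \<Rightarrow> complex) \<Rightarrow> ('a \<Rightarrow> complex) \<Rightarrow> bool" where
  "supp_le M z x \<longleftrightarrow> (AE t in M. z t \<noteq> 0 \<longrightarrow> x t \<noteq> 0)"

text \<open>
  Closure under shrinking supports, for families in spaces satisfying \<open>K\<close>. Any two spaces over
  the same measure space lie in a common interpolation scale, namely that of the couple which they form.
\<close>

definition support_closed :: "('a fspace \<Rightarrow> bool) \<Rightarrow> 'a families \<Rightarrow> bool" where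
  "support_closed K S \<longleftrightarrow>
     (\<forall>(X, xs)\<in>S. K X \<and> set xs \<subseteq> elts X) \<and>
     (\<forall>X xs Y zs. (X, xs) \<in> S \<and> K Y \<and> meas Y = meas X \<and> set zs \<subseteq> elts Y \<and>
        length zs = length xs \<and> (\<forall>i<length xs. supp_le (meas X) (zs ! i) (xs ! i)) \<longrightarrow>
        (Y, zs) \<in> S)"

text \<open>
  Generating sequences are nonzero up to some index, possibly infinite, and zero from there on; thus
  finitely many generators are allowed.
\<close>

definition generators :: "'a fspace \<Rightarrow> (nat \<Rightarrow> 'a \<Rightarrow> complex) \<Rightarrow> bool" where
  "generators X w \<longleftrightarrow>
     (\<forall>k. w k \<in> elts X) \<and>
     (\<forall>k. (AE t in meas X. w k t = 0) \<longrightarrow> (AE t in meas X. w (Suc k) t = 0))"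

definition disjoint_vectors :: "'a fspace \<Rightarrow> (nat \<Rightarrow> 'a \<Rightarrow> complex) \<Rightarrow> bool" where
  "disjoint_vectors X w \<longleftrightarrow>
     generators X w \<and> (\<forall>j k. j \<noteq> k \<longrightarrow> (AE t in meas X. w j t = 0 \<or> w k t = 0))"

definition successive_vectors :: "nat fspace \<Rightarrow> (nat \<Rightarrow> nat \<Rightarrow> complex) \<Rightarrow> bool" where
  "successive_vectors X w \<longleftrightarrow>
     generators X w \<and> (\<forall>k. finite {p. w k p \<noteq> 0}) \<and>
     (\<forall>j k p q. j < k \<and> w j p \<noteq> 0 \<and> w k q \<noteq> 0 \<longrightarrow> p < q)"

definition series_of ::
    "'a fspace \<Rightarrow> (nat \<Rightarrow> 'a \<Rightarrow> complex) \<Rightarrow> (nat \<Rightarrow> complex) \<Rightarrow> ('a \<Rightarrow> complex) \<Rightarrow> bool" where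
  "series_of X w a f \<longleftrightarrow>
     f \<in> elts X \<and> (\<lambda>N. nrm X (\<lambda>t. f t - (\<Sum>k<N. a k * w k t))) \<longlonglongrightarrow> 0"

text \<open>
  The closed span of a sequence \<open>w\<close> of disjoint vectors has the nonzero \<open>w k\<close> as a 1-unconditional
  basis. As a space on the natural numbers it consists of the coefficient sequences of its elements.
\<close>

definition span_space :: "'a fspace \<Rightarrow> (nat \<Rightarrow> 'a \<Rightarrow> complex) \<Rightarrow> nat fspace" where
  "span_space X w = \<lparr>
     meas = count_space UNIV,
     elts = {a. (\<forall>k. (AE t in meas X. w k t = 0) \<longrightarrow> a k = 0) \<and> (\<exists>f. series_of X w a f)},
     nrm = (\<lambda>a. nrm X (SOME f. series_of X w a f)) \<rparr>"

text \<open>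
  Families in a subspace generated by disjoint or successive vectors also count in the whole space.
  Here \<open>D\<close> is the kind of generators (disjoint or successive) and \<open>K\<close> the kind of spaces.
\<close>

definition passes_to_superspaces ::
    "('a fspace \<Rightarrow> bool) \<Rightarrow> ('a fspace \<Rightarrow> (nat \<Rightarrow> 'a \<Rightarrow> complex) \<Rightarrow> bool) \<Rightarrow>
     nat families \<Rightarrow> 'a families \<Rightarrow> bool" where
  "passes_to_superspaces K D T S \<longleftrightarrow>
     (\<forall>X w cs xs. K X \<and> D X w \<and> (span_space X w, cs) \<in> T \<and> list_all2 (series_of X w) cs xs \<longrightarrow>
        (X, xs) \<in> S)"

text \<open>
  A standard class of families in Koethe function spaces is a class ranging over all measure spaces.
  It is represented by its part \<open>S\<close> on measure spaces with points in \<open>'a\<close> together with its part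
  \<open>T\<close> on measure spaces with points in the natural numbers, to which the spaces spanned by disjoint
  vectors belong. Other parts of the class impose no condition on these two, so every
  such pair comes from a class ranging over all measure spaces.
\<close>

definition standard_class :: "'a families \<Rightarrow> nat families \<Rightarrow> bool" where
  "standard_class S T \<longleftrightarrow>
     support_closed kothe S \<and> support_closed kothe T \<and>
     passes_to_superspaces kothe disjoint_vectors T S \<and>
     passes_to_superspaces kothe disjoint_vectors T T"

text \<open>The respective notion for spaces with 1-unconditional bases.\<close>

definition standard_basis_class :: "nat families \<Rightarrow> bool" where
  "standard_basis_class T \<longleftrightarrow>
     support_closed basis_space T \<and> passes_to_superspaces basis_space successive_vectors T T"

definition fsum :: "('a \<Rightarrow> complex) list \<Rightarrow> 'a \<Rightarrow> complex" where
  "fsum xs = (\<lambda>t. \<Sum>x\<leftarrow>xs. x t)"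

definition M_sup :: "'a families \<Rightarrow> 'a fspace \<Rightarrow> nat \<Rightarrow> real" where
  "M_sup S X n =
     Sup {nrm X (fsum xs) | xs. (X, xs) \<in> S \<and> length xs = n \<and> (\<forall>x\<in>set xs. nrm X x \<le> 1)}"


section \<open>Complex interpolation\<close>

definition strip :: "complex set" where
  "strip = {z. 0 \<le> Re z \<and> Re z \<le> 1}"

definition sum_space :: "'a fspace \<Rightarrow> 'a fspace \<Rightarrow> 'a fspace" where
  "sum_space X0 X1 = \<lparr>
     meas = meas X0,
     elts = {f \<in> borel_measurable (meas X0).
               \<exists>a\<in>elts X0. \<exists>b\<in>elts X1. AE t in meas X0. f t = a t + b t},
     nrm = (\<lambda>f. Inf {nrm X0 a + nrm X1 b | a b.
               a \<in> elts X0 \<and> b \<in> elts X1 \<and> (AE t in meas X0. f t = a t + b t)}) \<rparr>"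

definition continuous_into :: "'a fspace \<Rightarrow> 'z::topological_space set \<Rightarrow> ('z \<Rightarrow> 'a \<Rightarrow> complex) \<Rightarrow> bool" where
  "continuous_into Y A g \<longleftrightarrow>
     (\<forall>z\<in>A. g z \<in> elts Y) \<and>
     (\<forall>z\<in>A. ((\<lambda>w. nrm Y (\<lambda>t. g w t - g z t)) \<longlongrightarrow> 0) (at z within A))"

definition bounded_into :: "'a fspace \<Rightarrow> 'z set \<Rightarrow> ('z \<Rightarrow> 'a \<Rightarrow> complex) \<Rightarrow> bool" where
  "bounded_into Y A g \<longleftrightarrow> (\<forall>z\<in>A. g z \<in> elts Y) \<and> bdd_above ((\<lambda>z. nrm Y (g z)) ` A)"

definition analytic_into :: "'a fspace \<Rightarrow> complex set \<Rightarrow> (complex \<Rightarrow> 'a \<Rightarrow> complex) \<Rightarrow> bool" where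
  "analytic_into Y U g \<longleftrightarrow>
     (\<forall>z\<in>U. \<exists>r>0. \<exists>c. ball z r \<subseteq> U \<and> (\<forall>k. c k \<in> elts Y) \<and>
        (\<forall>w\<in>ball z r. g w \<in> elts Y \<and>
           (\<lambda>N. nrm Y (\<lambda>t. g w t - (\<Sum>k<N. (w - z) ^ k * c k t))) \<longlonglongrightarrow> 0))"

definition calderon :: "'a fspace \<Rightarrow> 'a fspace \<Rightarrow> (complex \<Rightarrow> 'a \<Rightarrow> complex) set" where
  "calderon X0 X1 = {g.
     bounded_into (sum_space X0 X1) strip g \<and>
     continuous_into (sum_space X0 X1) strip g \<and>
     analytic_into (sum_space X0 X1) (interior strip) g \<and>
     bounded_into X0 UNIV (\<lambda>s. g (Complex 0 s)) \<and> continuous_into X0 UNIV (\<lambda>s. g (Complex 0 s)) \<and>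
     bounded_into X1 UNIV (\<lambda>s. g (Complex 1 s)) \<and> continuous_into X1 UNIV (\<lambda>s. g (Complex 1 s))}"

definition calderon_norm :: "'a fspace \<Rightarrow> 'a fspace \<Rightarrow> (complex \<Rightarrow> 'a \<Rightarrow> complex) \<Rightarrow> real" where
  "calderon_norm X0 X1 g =
     Sup (range (\<lambda>s. nrm X0 (g (Complex 0 s))) \<union> range (\<lambda>s. nrm X1 (g (Complex 1 s))))"

definition interp :: "'a fspace \<Rightarrow> 'a fspace \<Rightarrow> real \<Rightarrow> 'a fspace" where
  "interp X0 X1 \<theta> = \<lparr>
     meas = meas X0,
     elts = {f \<in> borel_measurable (meas X0).
               \<exists>g\<in>calderon X0 X1. AE t in meas X0. f t = g (of_real \<theta>) t},
     nrm = (\<lambda>f. Inf {calderon_norm X0 X1 g | g.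
               g \<in> calderon X0 X1 \<and> (AE t in meas X0. f t = g (of_real \<theta>) t)}) \<rparr>"


section \<open>The induced centralizer\<close>

text \<open>
  The first clause says that \<open>B\<close> is a map on classes of functions.
\<close>

definition selector ::
    "'a fspace \<Rightarrow> 'a fspace \<Rightarrow> real \<Rightarrow> real \<Rightarrow> (('a \<Rightarrow> complex) \<Rightarrow> complex \<Rightarrow> 'a \<Rightarrow> complex) \<Rightarrow> bool" where
  "selector X0 X1 \<theta> \<epsilon> B \<longleftrightarrow>
     (let X = interp X0 X1 \<theta>; M = meas X0 in
       (\<forall>x\<in>elts X. \<forall>y\<in>elts X. (AE t in M. x t = y t) \<longrightarrow>
          (\<forall>z\<in>strip. AE t in M. B x z t = B y z t)) \<and>
       (\<forall>x\<in>elts X. B x \<in> calderon X0 X1 \<and>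
          (AE t in M. B x (of_real \<theta>) t = x t) \<and>
          calderon_norm X0 X1 (B x) \<le> (1 + \<epsilon>) * nrm X x \<and>
          (\<forall>z\<in>strip. supp_le M (B x z) x)) \<and>
       (\<forall>c. \<forall>x\<in>elts X. \<forall>z\<in>strip. AE t in M. B (\<lambda>s. c * x s) z t = c * B x z t))"

definition has_deriv_into ::
    "'a fspace \<Rightarrow> (complex \<Rightarrow> 'a \<Rightarrow> complex) \<Rightarrow> complex \<Rightarrow> ('a \<Rightarrow> complex) \<Rightarrow> bool" where
  "has_deriv_into Y g z d \<longleftrightarrow>
     d \<in> elts Y \<and> ((\<lambda>w. nrm Y (\<lambda>t. (g w t - g z t) / (w - z) - d t)) \<longlongrightarrow> 0) (at z)"

text \<open>
  The derivative is unique up to equality almost everywhere; \<open>SOME\<close> picks a representative.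
\<close>

definition centralizer ::
    "'a fspace \<Rightarrow> 'a fspace \<Rightarrow> real \<Rightarrow> (('a \<Rightarrow> complex) \<Rightarrow> complex \<Rightarrow> 'a \<Rightarrow> complex) \<Rightarrow>
     ('a \<Rightarrow> complex) \<Rightarrow> 'a \<Rightarrow> complex" where
  "centralizer X0 X1 \<theta> B x = (SOME d. has_deriv_into (sum_space X0 X1) (B x) (of_real \<theta>) d)"

definition defect ::
    "'a families \<Rightarrow> 'a fspace \<Rightarrow> 'a fspace \<Rightarrow> (('a \<Rightarrow> complex) \<Rightarrow> 'a \<Rightarrow> complex) \<Rightarrow>
     ('a \<Rightarrow> complex) list \<Rightarrow> 'a \<Rightarrow> complex" where
  "defect S X0 X1 \<Omega> xs = (\<lambda>t. \<Omega> (fsum xs) t - (\<Sum>x\<leftarrow>xs. \<Omega> x t)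
     - of_real (ln (M_sup S X0 (length xs) / M_sup S X1 (length xs))) * fsum xs t)"

end

theory Submission
  imports Defs "HOL-Complex_Analysis.Cauchy_Integral_Formula"
begin

text \<open>
  Write \<open>B\<close> for the selector and let \<open>a \<ge> M_sup S X0 n\<close>, \<open>b \<ge> M_sup S X1 n\<close> be positive. The supports of the
  \<open>B x\<^sub>i z\<close> shrink, so their sum is bounded by \<open>(1 + \<epsilon>) a\<close> and \<open>(1 + \<epsilon>) b\<close> on the two boundary lines, and
  multiplying it by \<open>(a / b)\<close> to the power \<open>z - \<theta>\<close> balances both bounds to \<open>(1 + \<epsilon>) E\<close> with
  \<open>E = a powr (1 - \<theta>) * b powr \<theta>\<close>. The difference \<open>K\<close> of \<open>B (\<Sum> x\<^sub>i)\<close> and this product has norm at most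
  \<open>((1 + \<epsilon>)\<^sup>2 + (1 + \<epsilon>)) E \<le> 3 E\<close> and vanishes at \<open>\<theta>\<close>. Hence \<open>K z / (z - \<theta>)\<close> belongs to the Calderon
  space, and its value at \<open>\<theta>\<close>, the derivative of \<open>K\<close>, is the defect.
\<close>

section \<open>Seminormed spaces of functions\<close>

text \<open>The two features of the final bound have separate sources. The balancing factor has
  value 1 and derivative log (a / b) at \<theta>, which is the logarithm in the defect; dividing by
  z - \<theta> on the boundary lines costs the distance from \<theta> to them. The constant 3 is a
  round bound for (5/4)^2 + 5/4 = 45/16, the limit case \<epsilon> = 1/4. The obstacle is the
  quotient at the removed singularity. Its value there has to be the derivative assembled from the
  representatives chosen in \<open>centralizer\<close>, while a power series fixes its coefficients
  only up to functions of norm 0. Functions are therefore kept as representatives in a seminormed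
  space, analyticity is handled through explicit power series, and the vanishing of K at \<theta> is
  used in the form that K(\<theta>) has norm 0 in the sum space. Since a and b are arbitrary
  positive bounds, a supremum that vanishes can be approached from above.\<close>

locale seminormed_fspace =
  fixes Y :: "'a fspace"
  assumes zero_closed: "(\<lambda>_. 0) \<in> elts Y"
    and add_closed: "f \<in> elts Y \<Longrightarrow> g \<in> elts Y \<Longrightarrow> (\<lambda>t. f t + g t) \<in> elts Y"
    and nrm_add_le: "f \<in> elts Y \<Longrightarrow> g \<in> elts Y \<Longrightarrow> nrm Y (\<lambda>t. f t + g t) \<le> nrm Y f + nrm Y g"
    and scale_closed: "f \<in> elts Y \<Longrightarrow> (\<lambda>t. c * f t) \<in> elts Y"
    and nrm_scale: "f \<in> elts Y \<Longrightarrow> nrm Y (\<lambda>t. c * f t) = cmod c * nrm Y f"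
    and nrm_nonneg: "f \<in> elts Y \<Longrightarrow> 0 \<le> nrm Y f"
    and nrm_cong_AE: "f \<in> elts Y \<Longrightarrow> g \<in> elts Y \<Longrightarrow> AE t in meas Y. f t = g t \<Longrightarrow> nrm Y f = nrm Y g"
begin

lemma diff_closed: "f \<in> elts Y \<Longrightarrow> g \<in> elts Y \<Longrightarrow> (\<lambda>t. f t - g t) \<in> elts Y"
  using add_closed[OF _ scale_closed, of f g "-1"] by simp

lemma divide_closed: "f \<in> elts Y \<Longrightarrow> (\<lambda>t. f t / c) \<in> elts Y"
  using scale_closed[of f "1/c"] by simp

lemma nrm_divide: "f \<in> elts Y \<Longrightarrow> nrm Y (\<lambda>t. f t / c) = nrm Y f / cmod c"
  using nrm_scale[of f "1/c"] by (simp add: norm_divide)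

lemma nrm_diff_le: "f \<in> elts Y \<Longrightarrow> g \<in> elts Y \<Longrightarrow> nrm Y (\<lambda>t. f t - g t) \<le> nrm Y f + nrm Y g"
  using nrm_add_le[OF _ scale_closed, of f g "-1"] nrm_scale[of g "-1"] by simp

lemma nrm_zero: "nrm Y (\<lambda>_. 0) = 0"
  using nrm_scale[OF zero_closed, of 0] by simp

lemma sum_closed: "(\<And>i. i \<in> I \<Longrightarrow> f i \<in> elts Y) \<Longrightarrow> (\<lambda>t. \<Sum>i\<in>I. f i t) \<in> elts Y"
  by (induction I rule: infinite_finite_induct) (auto intro: zero_closed add_closed)

lemma nrm_sum_le:
  "(\<And>i. i \<in> I \<Longrightarrow> f i \<in> elts Y) \<Longrightarrow> nrm Y (\<lambda>t. \<Sum>i\<in>I. f i t) \<le> (\<Sum>i\<in>I. nrm Y (f i))"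
proof (induction I rule: infinite_finite_induct)
  case (insert i I)
  then show ?case
    using nrm_add_le[of "f i" "\<lambda>t. \<Sum>i\<in>I. f i t"] sum_closed[of I f] by fastforce
qed (auto simp: nrm_zero)

lemma fsum_closed: "set xs \<subseteq> elts Y \<Longrightarrow> fsum xs \<in> elts Y"
  by (induction xs) (auto simp: fsum_def intro: zero_closed add_closed)

lemma nrm_fsum_le: "set xs \<subseteq> elts Y \<Longrightarrow> nrm Y (fsum xs) \<le> (\<Sum>x\<leftarrow>xs. nrm Y x)"
proof (induction xs)
  case (Cons x xs)
  then show ?case using nrm_add_le[of x "fsum xs"] fsum_closed[of xs]
    by (auto simp: fsum_def)
qed (auto simp: fsum_def nrm_zero)

lemmas closed = zero_closed add_closed scale_closed diff_closed divide_closed sum_closed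

end

text \<open>All laws but one are clauses of \<open>kothe\<close>. Invariance of the norm under
  equality almost everywhere follows from the ideal property, applied in both directions.\<close>

lemma kothe_seminormed:
  assumes "kothe X"
  shows "seminormed_fspace X"
proof
  fix f g assume *: "f \<in> elts X" "g \<in> elts X" "AE t in meas X. f t = g t"
  then have "f \<in> borel_measurable (meas X)" "g \<in> borel_measurable (meas X)"
    using assms by (auto simp: kothe_def)
  moreover have "AE t in meas X. cmod (f t) \<le> cmod (g t)" "AE t in meas X. cmod (g t) \<le> cmod (f t)"
    using *(3) by (auto elim: AE_mp)
  ultimately show "nrm X f = nrm X g"
    using assms * unfolding kothe_def by (meson order_antisym)
qed (use assms in \<open>auto simp: kothe_def\<close>)

lemma meas_sum_space [simp]: "meas (sum_space X0 X1) = meas X0"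
  by (simp add: sum_space_def)

lemma meas_interp [simp]: "meas (interp X0 X1 \<theta>) = meas X0"
  by (simp add: interp_def)

text \<open>The infimum over decompositions need not be attained, so decompositions are taken that
  are optimal up to an error, and the error is then removed.\<close>

lemma sum_space_seminormed:
  assumes "admissible_couple X0 X1"
  shows "seminormed_fspace (sum_space X0 X1)"
proof -
  let ?Y = "sum_space X0 X1" and ?M = "meas X0"
  let ?D = "\<lambda>f a b. a \<in> elts X0 \<and> b \<in> elts X1 \<and> (AE t in ?M. f t = a t + b t)"
  interpret X0: seminormed_fspace X0
    using assms by (auto simp: admissible_couple_def intro: kothe_seminormed)
  interpret X1: seminormed_fspace X1
    using assms by (auto simp: admissible_couple_def intro: kothe_seminormed)
  have elts: "f \<in> elts ?Y \<longleftrightarrow> f \<in> borel_measurable ?M \<and> (\<exists>a b. ?D f a b)" for f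
    by (auto simp: sum_space_def)
  have nrm: "nrm ?Y f = Inf {nrm X0 a + nrm X1 b | a b. ?D f a b}" for f
    by (simp add: sum_space_def)
  have bdd: "bdd_below {nrm X0 a + nrm X1 b | a b. ?D f a b}" for f
    by (rule bdd_belowI[of _ 0]) (auto simp: X0.nrm_nonneg X1.nrm_nonneg)
  have nonneg: "0 \<le> nrm ?Y f" if "f \<in> elts ?Y" for f
    using that unfolding nrm elts
    by (intro cInf_greatest) (auto simp: X0.nrm_nonneg X1.nrm_nonneg)
  have le: "nrm ?Y f \<le> nrm X0 a + nrm X1 b" if "?D f a b" for f a b
    unfolding nrm using that by (intro cInf_lower bdd) auto
  have approx: "\<exists>a b. ?D f a b \<and> nrm X0 a + nrm X1 b < nrm ?Y f + e"
    if "f \<in> elts ?Y" "e > 0" for f e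
  proof -
    have "{nrm X0 a + nrm X1 b | a b. ?D f a b} \<noteq> {}" using that unfolding elts by auto
    moreover have "Inf {nrm X0 a + nrm X1 b | a b. ?D f a b} < nrm ?Y f + e"
      unfolding nrm using that by simp
    ultimately obtain y where "y \<in> {nrm X0 a + nrm X1 b | a b. ?D f a b}" "y < nrm ?Y f + e"
      by (rule cInf_lessD[THEN bexE])
    then show ?thesis by auto
  qed
  have D_scale: "?D (\<lambda>t. c * f t) (\<lambda>t. c * a t) (\<lambda>t. c * b t)" if "?D f a b" for c f a b
  proof -
    have "AE t in ?M. f t = a t + b t" using that by auto
    then have "AE t in ?M. c * f t = c * a t + c * b t" by eventually_elim (simp add: distrib_left)
    then show ?thesis using that by (auto intro: X0.scale_closed X1.scale_closed)
  qed
  have D_add: "?D (\<lambda>t. f t + g t) (\<lambda>t. a t + a' t) (\<lambda>t. b t + b' t)" if "?D f a b" "?D g a' b'" for f g a b a' b'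
  proof -
    have "AE t in ?M. f t = a t + b t" "AE t in ?M. g t = a' t + b' t" using that by auto
    then have "AE t in ?M. f t + g t = a t + a' t + (b t + b' t)" by eventually_elim simp
    then show ?thesis using that by (auto intro: X0.add_closed X1.add_closed)
  qed
  have scale: "(\<lambda>t. c * f t) \<in> elts ?Y" if f: "f \<in> elts ?Y" for c f
  proof -
    obtain a b where "?D f a b" using f unfolding elts by auto
    from D_scale[OF this, of c] f show ?thesis unfolding elts by auto
  qed
  have scale_le: "nrm ?Y (\<lambda>t. c * f t) \<le> cmod c * nrm ?Y f" if f: "f \<in> elts ?Y" for c f
  proof (rule field_le_epsilon)
    fix e :: real assume "e > 0"
    \<comment> \<open>The summand 1 keeps the denominator positive when c = 0, and
      \<open>cmod c * e'\<close> is still at most \<open>e\<close>.\<close>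
    define e' where "e' = e / (cmod c + 1)"
    have "e' > 0" using \<open>e > 0\<close> by (simp add: e'_def add_nonneg_pos)
    then obtain a b where ab: "?D f a b" "nrm X0 a + nrm X1 b < nrm ?Y f + e'"
      using approx[OF f] by metis
    have "nrm ?Y (\<lambda>t. c * f t) \<le> cmod c * nrm X0 a + cmod c * nrm X1 b"
      using le[OF D_scale[OF ab(1), of c]] ab(1) by (simp add: X0.nrm_scale X1.nrm_scale)
    also have "\<dots> \<le> cmod c * (nrm ?Y f + e')"
      using ab(2) by (simp flip: distrib_left add: mult_left_mono)
    also have "\<dots> \<le> cmod c * nrm ?Y f + e"
    proof -
      have "cmod c * e' \<le> (cmod c + 1) * e'" using \<open>e' > 0\<close> by (simp add: mult_right_mono)
      also have "\<dots> = e" using norm_ge_zero[of c] by (simp add: e'_def add_nonneg_eq_0_iff)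
      finally show ?thesis by (simp add: distrib_left)
    qed
    finally show "nrm ?Y (\<lambda>t. c * f t) \<le> cmod c * nrm ?Y f + e" .
  qed
  show ?thesis
  proof
    show "(\<lambda>_. 0) \<in> elts ?Y" unfolding elts
      using X0.zero_closed X1.zero_closed by force
  next
    fix f g assume fg: "f \<in> elts ?Y" "g \<in> elts ?Y"
    then obtain a b a' b' where "?D f a b" "?D g a' b'" unfolding elts by auto
    from D_add[OF this] fg show "(\<lambda>t. f t + g t) \<in> elts ?Y" unfolding elts by auto
    show "nrm ?Y (\<lambda>t. f t + g t) \<le> nrm ?Y f + nrm ?Y g"
    proof (rule field_le_epsilon)
      fix e :: real assume "e > 0"
      then obtain a b a' b' where D: "?D f a b" "?D g a' b'" and
        "nrm X0 a + nrm X1 b < nrm ?Y f + e/2" "nrm X0 a' + nrm X1 b' < nrm ?Y g + e/2"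
        using approx[OF fg(1), of "e/2"] approx[OF fg(2), of "e/2"] by auto
      moreover have "nrm X0 (\<lambda>t. a t + a' t) \<le> nrm X0 a + nrm X0 a'"
        "nrm X1 (\<lambda>t. b t + b' t) \<le> nrm X1 b + nrm X1 b'"
        using D by (auto intro: X0.nrm_add_le X1.nrm_add_le)
      ultimately show "nrm ?Y (\<lambda>t. f t + g t) \<le> nrm ?Y f + nrm ?Y g + e"
        using le[OF D_add[OF D]] by linarith
    qed
  next
    fix f c assume f: "f \<in> elts ?Y"
    show "(\<lambda>t. c * f t) \<in> elts ?Y" by (rule scale[OF f])
    show "nrm ?Y (\<lambda>t. c * f t) = cmod c * nrm ?Y f"
    proof (rule antisym[OF scale_le[OF f]])
      \<comment> \<open>The reverse inequality is the one just proved, applied to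
        \<open>c * f\<close> with the factor 1/c.\<close>
      show "cmod c * nrm ?Y f \<le> nrm ?Y (\<lambda>t. c * f t)"
      proof (cases "c = 0")
        case True
        then show ?thesis using nonneg[OF scale[OF f, of 0]] by simp
      next
        case False
        then have "nrm ?Y f \<le> cmod (1/c) * nrm ?Y (\<lambda>t. c * f t)"
          using scale_le[OF scale[OF f], of "1/c" c] by simp
        then show ?thesis using False by (simp add: norm_divide field_simps)
      qed
    qed
    show "0 \<le> nrm ?Y f" by (rule nonneg[OF f])
  next
    fix f g :: "'a \<Rightarrow> complex" assume "AE t in meas ?Y. f t = g t"
    then have fg: "AE t in ?M. f t = g t" unfolding meas_sum_space .
    have "?D f a b \<longleftrightarrow> ?D g a b" for a b
    proof -
      have "(AE t in ?M. f t = a t + b t) \<longleftrightarrow> (AE t in ?M. g t = a t + b t)"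
        by (rule eventually_subst) (use fg in eventually_elim, simp)
      then show ?thesis by simp
    qed
    then show "nrm ?Y f = nrm ?Y g" unfolding nrm by simp
  qed
qed

section \<open>Power series\<close>

text \<open>The local condition inside \<open>analytic_into\<close>, with radius and coefficients
  made explicit so that they can be followed through sums, products and division.\<close>

definition has_power_series ::
    "'a fspace \<Rightarrow> (complex \<Rightarrow> 'a \<Rightarrow> complex) \<Rightarrow> complex \<Rightarrow> real \<Rightarrow> (nat \<Rightarrow> 'a \<Rightarrow> complex) \<Rightarrow> bool" where
  "has_power_series Y g z r c \<longleftrightarrow>
     (\<forall>k. c k \<in> elts Y) \<and>
     (\<forall>w\<in>ball z r. g w \<in> elts Y \<and>
        (\<lambda>N. nrm Y (\<lambda>t. g w t - (\<Sum>k<N. (w - z) ^ k * c k t))) \<longlonglongrightarrow> 0)"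

lemma analytic_into_iff:
  "analytic_into Y U g \<longleftrightarrow> (\<forall>z\<in>U. \<exists>r>0. \<exists>c. ball z r \<subseteq> U \<and> has_power_series Y g z r c)"
  by (simp add: analytic_into_def has_power_series_def)

lemma has_power_series_subset:
  "has_power_series Y g z r c \<Longrightarrow> s \<le> r \<Longrightarrow> has_power_series Y g z s c"
  by (auto simp: has_power_series_def)

lemma analytic_into_common_radius:
  assumes "analytic_into Y U f" "open V" "z \<in> U" "z \<in> V"
  obtains r c where "r > 0" "ball z r \<subseteq> U \<inter> V" "has_power_series Y f z r c"
proof -
  obtain r c where r: "r > 0" "ball z r \<subseteq> U" "has_power_series Y f z r c"
    using assms(1,3) by (auto simp: analytic_into_iff)
  obtain s where s: "s > 0" "ball z s \<subseteq> V"
    using assms(2,4) open_contains_ball by blast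
  show thesis
  proof
    show "min r s > 0" using r s by simp
    show "ball z (min r s) \<subseteq> U \<inter> V" using r(2) s(2) by auto
    show "has_power_series Y f z (min r s) c" using r(3) by (rule has_power_series_subset) simp
  qed
qed

text \<open>Each term a_j e(N - j) tends to 0 and is dominated by a_j C, where C bounds the null
  sequence, so Tannery's theorem applies. This is the limit behind the product of a scalar and a
  vector-valued power series.\<close>

lemma convolution_tendsto_0:
  fixes a e :: "nat \<Rightarrow> real"
  assumes a: "summable a" "\<And>k. 0 \<le> a k" and e: "e \<longlonglongrightarrow> 0"
  shows "(\<lambda>N. \<Sum>j<N. a j * e (N - j)) \<longlonglongrightarrow> 0"
proof -
  obtain C where C: "\<And>n. \<bar>e n\<bar> \<le> C"
    using convergent_imp_Bseq[of e] e by (auto simp: convergent_def Bseq_def)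
  \<comment> \<open>Padding with zeros for j \<ge> N turns the sums of growing length into full
    series, as dominated convergence requires.\<close>
  define b where "b = (\<lambda>j N. if j < N then a j * e (N - j) else 0)"
  have lim: "(\<lambda>N. b j N) \<longlonglongrightarrow> 0" for j
  proof -
    have "(\<lambda>N. e (N - j)) \<longlonglongrightarrow> 0"
      using e by (simp add: LIMSEQ_offset[of _ j])
    then have "(\<lambda>N. a j * e (N - j)) \<longlonglongrightarrow> 0"
      by (rule tendsto_mult_right_zero)
    moreover have "eventually (\<lambda>N. a j * e (N - j) = b j N) sequentially"
      unfolding b_def using eventually_gt_at_top[of j] by eventually_elim simp
    ultimately show ?thesis by (rule Lim_transform_eventually)
  qed
  have "norm (b j N) \<le> a j * C" for j N
    using C[of "N - j"] C[of 0] a(2)[of j] by (auto simp: b_def abs_mult intro!: mult_left_mono)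
  then have bound: "eventually (\<lambda>(k, n). norm (b k n) \<le> a k * C) (at_top \<times>\<^sub>F sequentially)"
    by (intro always_eventually) auto
  have "(\<lambda>N. suminf (\<lambda>j. b j N)) \<longlonglongrightarrow> suminf (\<lambda>_. 0)"
    using tannerys_theorem[OF lim bound] a(1) by (simp add: summable_mult2)
  moreover have "suminf (\<lambda>j. b j N) = (\<Sum>j<N. a j * e (N - j))" for N
    using suminf_finite[of "{..<N}" "\<lambda>j. b j N"] by (simp add: b_def)
  ultimately show ?thesis by simp
qed

context seminormed_fspace
begin

lemma has_power_series_add:
  assumes f: "has_power_series Y f z r c" and g: "has_power_series Y g z r d"
  shows "has_power_series Y (\<lambda>w t. f w t + g w t) z r (\<lambda>k t. c k t + d k t)"
  unfolding has_power_series_def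
proof (intro conjI allI ballI)
  show "(\<lambda>t. c k t + d k t) \<in> elts Y" for k
    using f g by (auto simp: has_power_series_def intro: closed)
  fix w assume w: "w \<in> ball z r"
  let ?R = "\<lambda>f c N t. f w t - (\<Sum>k<N. (w - z) ^ k * c k t)"
  show "(\<lambda>t. f w t + g w t) \<in> elts Y"
    using f g w by (auto simp: has_power_series_def intro: closed)
  have R: "?R f c N \<in> elts Y" "?R g d N \<in> elts Y" for N
    using f g w by (auto simp: has_power_series_def intro!: closed)
  have eq: "(\<lambda>t. f w t + g w t - (\<Sum>k<N. (w - z) ^ k * (c k t + d k t))) = (\<lambda>t. ?R f c N t + ?R g d N t)" for N
    by (simp add: distrib_left sum.distrib fun_eq_iff)
  have "(\<lambda>N. nrm Y (?R f c N) + nrm Y (?R g d N)) \<longlonglongrightarrow> 0"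
    using f g w by (auto simp: has_power_series_def intro!: tendsto_add_zero)
  then show "(\<lambda>N. nrm Y (\<lambda>t. f w t + g w t - (\<Sum>k<N. (w - z) ^ k * (c k t + d k t)))) \<longlonglongrightarrow> 0"
    unfolding eq
    by (rule tendsto_sandwich[OF _ _ tendsto_const, rotated -1])
       (auto intro!: always_eventually nrm_nonneg nrm_add_le closed(2) R)
qed

text \<open>Mertens' argument for the Cauchy product: the scalar series converges absolutely,
  whereas of the vector series only norm convergence of the partial sums is known.\<close>

lemma has_power_series_mult:
  assumes \<psi>: "\<psi> holomorphic_on ball z r" and g: "has_power_series Y g z r c"
  defines "b \<equiv> \<lambda>k. (deriv ^^ k) \<psi> z / fact k"
  shows "has_power_series Y (\<lambda>w t. \<psi> w * g w t) z r (\<lambda>k t. \<Sum>j\<le>k. b j * c (k - j) t)"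
  unfolding has_power_series_def
proof (intro conjI allI ballI)
  have c: "c k \<in> elts Y" for k using g by (simp add: has_power_series_def)
  then show "(\<lambda>t. \<Sum>j\<le>k. b j * c (k - j) t) \<in> elts Y" for k by (auto intro!: closed)
  fix w assume w: "w \<in> ball z r"
  then have gw: "g w \<in> elts Y" using g by (simp add: has_power_series_def)
  then show "(\<lambda>t. \<psi> w * g w t) \<in> elts Y" by (rule closed)
  define u where "u = w - z"
  define R where "R = (\<lambda>N t. g w t - (\<Sum>k<N. u ^ k * c k t))"
  define \<rho> where "\<rho> = (\<lambda>N. \<psi> w - (\<Sum>j<N. b j * u ^ j))"
  have R: "R N \<in> elts Y" for N using c gw by (auto simp: R_def intro!: closed)
  have R0: "(\<lambda>N. nrm Y (R N)) \<longlonglongrightarrow> 0"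
    using g w by (simp add: has_power_series_def R_def u_def)
  have sums: "(\<lambda>k. b k * (v - z) ^ k) sums \<psi> v" if "v \<in> ball z r" for v
    using holomorphic_power_series[OF \<psi> that] by (simp add: b_def)
  have \<rho>0: "\<rho> \<longlonglongrightarrow> 0"
    unfolding \<rho>_def using tendsto_diff[OF tendsto_const sums[OF w, unfolded sums_def], of "\<psi> w"]
    by (simp add: u_def)
  \<comment> \<open>Convergence at a point of the ball farther from the center than \<open>w\<close>
    gives absolute convergence at \<open>w\<close>.\<close>
  have abs: "summable (\<lambda>k. cmod (b k * u ^ k))"
  proof -
    obtain s where s: "cmod u < s" "s < r"
      using w dense[of "cmod u" r] by (auto simp: u_def dist_norm norm_minus_commute)
    moreover have s0: "0 < s" using s(1) norm_ge_zero[of u] by linarith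
    ultimately have "z + of_real s \<in> ball z r"
      by (simp add: dist_norm)
    from sums[OF this] have "summable (\<lambda>k. b k * of_real s ^ k)"
      by (auto simp: sums_iff)
    moreover have "cmod u < cmod (of_real s)" using s s0 by simp
    ultimately show ?thesis by (rule powser_insidea)
  qed
  have reindex: "(\<Sum>k<N. u ^ k * (\<Sum>j\<le>k. b j * c (k - j) t)) =
    (\<Sum>j<N. b j * u ^ j * (\<Sum>i<N - j. u ^ i * c i t))" for N t
  proof -
    have "(\<Sum>k<N. u ^ k * (\<Sum>j\<le>k. b j * c (k - j) t)) =
       (\<Sum>k<N. \<Sum>j\<le>k. b j * u ^ j * (u ^ (k - j) * c (k - j) t))"
      by (auto simp: sum_distrib_left mult_ac simp flip: power_add intro!: sum.cong)
    also have "\<dots> = (\<Sum>(j, i)\<in>{(j, i). j + i < N}. b j * u ^ j * (u ^ i * c i t))"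
      by (rule sum.triangle_reindex[symmetric])
    also have "{(j, i). j + i < N} = (SIGMA j:{..<N}. {..<N - j})" by auto
    also have "(\<Sum>(j, i)\<in>(SIGMA j:{..<N}. {..<N - j}). b j * u ^ j * (u ^ i * c i t)) =
      (\<Sum>j<N. b j * u ^ j * (\<Sum>i<N - j. u ^ i * c i t))"
      by (simp add: sum.Sigma[symmetric] sum_distrib_left)
    finally show ?thesis .
  qed
  \<comment> \<open>The remainder of the product splits into the coefficients convolved with the
    vector remainders \<open>R\<close>, and the scalar remainder \<open>\<rho>\<close> times the
    fixed vector g(w).\<close>
  have eq: "(\<lambda>t. \<psi> w * g w t - (\<Sum>k<N. (w - z) ^ k * (\<Sum>j\<le>k. b j * c (k - j) t))) =
    (\<lambda>t. (\<Sum>j<N. b j * u ^ j * R (N - j) t) + \<rho> N * g w t)" for N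
    unfolding u_def[symmetric] reindex
    by (simp add: fun_eq_iff R_def \<rho>_def algebra_simps sum_subtractf sum_distrib_left sum_distrib_right)
  have cl: "(\<lambda>t. (\<Sum>j<N. b j * u ^ j * R (N - j) t)) \<in> elts Y" "(\<lambda>t. \<rho> N * g w t) \<in> elts Y" for N
    using R gw by (auto intro!: closed)
  have le: "nrm Y (\<lambda>t. (\<Sum>j<N. b j * u ^ j * R (N - j) t) + \<rho> N * g w t)
    \<le> (\<Sum>j<N. cmod (b j * u ^ j) * nrm Y (R (N - j))) + cmod (\<rho> N) * nrm Y (g w)" for N
    using nrm_add_le[OF cl[of N]] nrm_sum_le[of "{..<N}" "\<lambda>j t. b j * u ^ j * R (N - j) t"] R gw
    by (simp add: nrm_scale scale_closed)
  have "(\<lambda>N. (\<Sum>j<N. cmod (b j * u ^ j) * nrm Y (R (N - j))) + cmod (\<rho> N) * nrm Y (g w)) \<longlonglongrightarrow> 0"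
    by (intro tendsto_add_zero convolution_tendsto_0 abs R0 tendsto_mult_left_zero tendsto_norm_zero \<rho>0) auto
  then show "(\<lambda>N. nrm Y (\<lambda>t. \<psi> w * g w t - (\<Sum>k<N. (w - z) ^ k * (\<Sum>j\<le>k. b j * c (k - j) t)))) \<longlonglongrightarrow> 0"
    unfolding eq
    by (rule tendsto_sandwich[OF _ _ tendsto_const, rotated -1])
       (auto intro!: always_eventually nrm_nonneg closed(2) cl le)
qed

lemma analytic_into_add:
  assumes f: "analytic_into Y U f" and g: "analytic_into Y U g"
  shows "analytic_into Y U (\<lambda>w t. f w t + g w t)"
  unfolding analytic_into_iff
proof
  fix z assume z: "z \<in> U"
  obtain r c where r: "r > 0" "ball z r \<subseteq> U" "has_power_series Y f z r c"
    using f z by (auto simp: analytic_into_iff)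
  obtain s d where s: "s > 0" "has_power_series Y g z s d"
    using g z by (auto simp: analytic_into_iff)
  have "has_power_series Y (\<lambda>w t. f w t + g w t) z (min r s) (\<lambda>k t. c k t + d k t)"
    by (intro has_power_series_add has_power_series_subset[OF r(3)] has_power_series_subset[OF s(2)]) auto
  moreover have "min r s > 0" "ball z (min r s) \<subseteq> U" using r s by auto
  ultimately show "\<exists>r>0. \<exists>c. ball z r \<subseteq> U \<and> has_power_series Y (\<lambda>w t. f w t + g w t) z r c"
    by blast
qed

text \<open>Stated at one point and with a separate domain \<open>V\<close> for the scalar factor,
  because the factor 1 / (w - \<theta>) is holomorphic only away from \<theta>.\<close>

lemma analytic_into_mult:
  assumes \<psi>: "\<psi> holomorphic_on V" "open V" and g: "analytic_into Y U g" and z: "z \<in> U" "z \<in> V"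
  shows "\<exists>r>0. \<exists>c. ball z r \<subseteq> U \<inter> V \<and> has_power_series Y (\<lambda>w t. \<psi> w * g w t) z r c"
proof -
  obtain r c where r: "r > 0" "ball z r \<subseteq> U \<inter> V" "has_power_series Y g z r c"
    using analytic_into_common_radius[OF g \<psi>(2) z] .
  then have "\<psi> holomorphic_on ball z r" using \<psi>(1) by (auto intro: holomorphic_on_subset)
  from has_power_series_mult[OF this r(3)] r show ?thesis by blast
qed

text \<open>At the center every nonempty partial sum equals \<open>c 0\<close>, so the sequence of
  norms is constant from index 1 on and must equal its limit 0. Equality of g(z) and
  \<open>c 0\<close> is thus obtained only in norm.\<close>

lemma power_series_at_center:
  assumes g: "has_power_series Y g z r c" and r: "r > 0"
  shows "nrm Y (\<lambda>t. g z t - c 0 t) = 0"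
proof -
  have "(\<lambda>N. nrm Y (\<lambda>t. g z t - (\<Sum>k<N. (z - z) ^ k * c k t))) \<longlonglongrightarrow> 0"
    using g r centre_in_ball[of z r] unfolding has_power_series_def by blast
  then have "(\<lambda>N. nrm Y (\<lambda>t. g z t - (\<Sum>k<Suc N. (z - z) ^ k * c k t))) \<longlonglongrightarrow> 0"
    by (rule LIMSEQ_Suc)
  moreover have "(\<Sum>k<Suc N. (z - z) ^ k * c k t) = c 0 t" for N t
    by (simp only: sum.lessThan_Suc_shift) (simp)
  ultimately show ?thesis by (simp add: LIMSEQ_const_iff)
qed

text \<open>A Cauchy-type bound on the coefficients makes the difference quotient minus
  \<open>c 1\<close> a geometric tail of size O(|w - z|).\<close>

lemma has_power_series_imp_deriv:
  assumes g: "has_power_series Y g z r c" and r: "r > 0"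
  shows "has_deriv_into Y g z (c 1)"
proof -
  have c: "c k \<in> elts Y" for k using g by (simp add: has_power_series_def)
  have gw: "g w \<in> elts Y" if "w \<in> ball z r" for w using g that by (simp add: has_power_series_def)
  have gz: "g z \<in> elts Y" using gw r by simp
  define R where "R = (\<lambda>w N t. g w t - (\<Sum>k<N. (w - z) ^ k * c k t))"
  have R: "R w N \<in> elts Y" if "w \<in> ball z r" for w N
    using c gw that by (auto simp: R_def intro!: closed)
  have R0: "(\<lambda>N. nrm Y (R w N)) \<longlonglongrightarrow> 0" if "w \<in> ball z r" for w
    using g that by (simp add: has_power_series_def R_def)
  \<comment> \<open>One point \<open>v\<close> at distance \<open>\<rho>\<close> suffices:
    consecutive remainders at \<open>v\<close> differ by \<open>\<rho> ^ k * c k\<close>, and they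
    are bounded because they converge, so \<open>c k\<close> has norm at most
    \<open>2 * C / \<rho> ^ k\<close>.\<close>
  define \<rho> where "\<rho> = r / 2"
  define v where "v = z + of_real \<rho>"
  have \<rho>: "0 < \<rho>" and v: "v \<in> ball z r" using r by (auto simp: \<rho>_def v_def dist_norm)
  obtain C where C: "\<And>N. nrm Y (R v N) \<le> C"
    using convergent_imp_Bseq[of "\<lambda>N. nrm Y (R v N)"] R0[OF v]
    by (auto simp: convergent_def Bseq_def abs_le_iff)
  have C0: "0 \<le> C" using C[of 0] nrm_nonneg[OF R[OF v, of 0]] by linarith
  have coeff: "nrm Y (c k) \<le> 2 * C / \<rho> ^ k" for k
  proof -
    have "(\<lambda>t. of_real \<rho> ^ k * c k t) = (\<lambda>t. R v k t - R v (Suc k) t)"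
      by (simp add: R_def v_def)
    then have "\<rho> ^ k * nrm Y (c k) \<le> nrm Y (R v k) + nrm Y (R v (Suc k))"
      using nrm_scale[OF c, of "of_real \<rho> ^ k" k] nrm_diff_le[OF R[OF v] R[OF v], of k "Suc k"] \<rho>
      by (simp add: norm_power)
    also have "\<dots> \<le> 2 * C" using C[of k] C[of "Suc k"] by simp
    finally show ?thesis using \<rho> by (simp add: field_simps)
  qed
  define Q where "Q = (\<lambda>w t. (g w t - g z t) / (w - z) - c 1 t)"
  have bound: "nrm Y (Q w) \<le> 4 * C / \<rho>\<^sup>2 * cmod (w - z)" if w: "w \<in> ball z (\<rho>/2)" "w \<noteq> z" for w
  proof -
    define u where "u = w - z"
    have u: "u \<noteq> 0" "cmod u < \<rho> / 2" using w by (auto simp: u_def dist_norm norm_minus_commute)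
    have wr: "w \<in> ball z r" using w \<rho> by (auto simp: \<rho>_def)
    \<comment> \<open>Three pieces: the remainder of order N + 2 divided by \<open>u\<close>, which
      vanishes as N grows; the difference of g(z) and \<open>c 0\<close>, of norm 0; and the terms
      from \<open>c 2\<close> on. In the last piece |u| < \<rho>/2 gives the ratio 1/2, and 4 is the
      2 of the coefficient bound times the bound 2 for the geometric sum.\<close>
    have "nrm Y (Q w) \<le> nrm Y (R w (N+2)) / cmod u + 4 * C / \<rho>\<^sup>2 * cmod u" for N
    proof -
      have "(\<Sum>k<N+2. u ^ k * c k t) = c 0 t + u * c 1 t + u * (\<Sum>k<N. u ^ Suc k * c (k+2) t)" for t
        by (simp only: add_2_eq_Suc' sum.lessThan_Suc_shift) (simp add: sum_distrib_left mult_ac)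
      then have "Q w = (\<lambda>t. (R w (N+2) t / u - (g z t - c 0 t) / u) + (\<Sum>k<N. u ^ Suc k * c (k+2) t))"
        using u by (simp add: Q_def R_def fun_eq_iff u_def[symmetric] field_simps)
      moreover have 1: "(\<lambda>t. R w (N+2) t / u - (g z t - c 0 t) / u) \<in> elts Y"
        and 2: "(\<lambda>t. \<Sum>k<N. u ^ Suc k * c (k+2) t) \<in> elts Y"
        using R[OF wr] gz c by (auto intro!: closed)
      moreover have "nrm Y (\<lambda>t. R w (N+2) t / u - (g z t - c 0 t) / u) \<le> nrm Y (R w (N+2)) / cmod u"
        using nrm_diff_le[OF divide_closed[OF R[OF wr, of "N+2"], of u] divide_closed[OF diff_closed[OF gz c[of 0]], of u]]
        by (simp add: nrm_divide R[OF wr] gz c closed power_series_at_center[OF g r])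
      moreover have "nrm Y (\<lambda>t. \<Sum>k<N. u ^ Suc k * c (k+2) t) \<le> 4 * C / \<rho>\<^sup>2 * cmod u"
      proof -
        have "nrm Y (\<lambda>t. \<Sum>k<N. u ^ Suc k * c (k+2) t) \<le> (\<Sum>k<N. cmod u ^ Suc k * nrm Y (c (k+2)))"
          using nrm_sum_le[of "{..<N}" "\<lambda>k t. u ^ Suc k * c (k+2) t"] c
          by (simp add: nrm_scale scale_closed norm_mult norm_power)
        also have "\<dots> \<le> (\<Sum>k<N. 2 * C / \<rho>\<^sup>2 * cmod u * (1/2) ^ k)"
        proof (rule sum_mono)
          fix k
          have "cmod u ^ Suc k * nrm Y (c (k+2)) \<le> cmod u ^ Suc k * (2 * C / \<rho> ^ (k+2))"
            by (intro mult_left_mono coeff) auto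
          also have "\<dots> = 2 * C / \<rho>\<^sup>2 * cmod u * (cmod u / \<rho>) ^ k"
            by (simp add: power_divide power_add power2_eq_square mult_ac)
          also have "\<dots> \<le> 2 * C / \<rho>\<^sup>2 * cmod u * (1/2) ^ k"
            using u \<rho> C0 by (intro mult_left_mono power_mono) (auto simp: field_simps)
          finally show "cmod u ^ Suc k * nrm Y (c (k+2)) \<le> 2 * C / \<rho>\<^sup>2 * cmod u * (1/2) ^ k" .
        qed
        also have "\<dots> = 2 * C / \<rho>\<^sup>2 * cmod u * (\<Sum>k<N. (1/2) ^ k)" by (simp add: sum_distrib_left)
        also have "\<dots> \<le> 2 * C / \<rho>\<^sup>2 * cmod u * 2"
          using C0 \<rho> geometric_sum[of "1/2::real" N] by (intro mult_left_mono) auto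
        finally show ?thesis by simp
      qed
      ultimately show ?thesis using nrm_add_le[OF 1 2] by simp
    qed
    moreover have "(\<lambda>N. nrm Y (R w (N+2)) / cmod u + 4 * C / \<rho>\<^sup>2 * cmod u) \<longlonglongrightarrow> 4 * C / \<rho>\<^sup>2 * cmod u"
      using tendsto_add[OF tendsto_divide[OF LIMSEQ_ignore_initial_segment[OF R0[OF wr], of 2] tendsto_const[of "cmod u"]]
          tendsto_const[of "4 * C / \<rho>\<^sup>2 * cmod u"]] u by simp
    ultimately show ?thesis unfolding u_def[symmetric]
      by (intro LIMSEQ_le_const) auto
  qed
  have "((\<lambda>w. 4 * C / \<rho>\<^sup>2 * cmod (w - z)) \<longlongrightarrow> 4 * C / \<rho>\<^sup>2 * cmod (z - z)) (at z)"
    by (intro tendsto_intros)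
  then have lim: "((\<lambda>w. 4 * C / \<rho>\<^sup>2 * cmod (w - z)) \<longlongrightarrow> 0) (at z)" by simp
  have near: "eventually (\<lambda>w. w \<in> ball z (\<rho>/2) - {z}) (at z)"
    using \<rho> by (intro eventually_at_in_open) auto
  have "((\<lambda>w. nrm Y (Q w)) \<longlongrightarrow> 0) (at z)"
  proof (rule tendsto_sandwich[OF _ _ tendsto_const lim])
    show "\<forall>\<^sub>F w in at z. 0 \<le> nrm Y (Q w)"
      using near
    proof eventually_elim
      case (elim w)
      then have "w \<in> ball z r" using \<rho> by (auto simp: \<rho>_def)
      then show ?case unfolding Q_def using gw gz c by (intro nrm_nonneg closed) auto
    qed
    show "\<forall>\<^sub>F w in at z. nrm Y (Q w) \<le> 4 * C / \<rho>\<^sup>2 * cmod (w - z)"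
      using near by eventually_elim (use bound in auto)
  qed
  then show ?thesis unfolding has_deriv_into_def Q_def using c by simp
qed

end

section \<open>The Calderon space\<close>

lemma bounded_into_iff: "bounded_into Y A g \<longleftrightarrow> (\<exists>C. \<forall>z\<in>A. g z \<in> elts Y \<and> nrm Y (g z) \<le> C)"
  by (auto simp: bounded_into_def bdd_above_def)

context seminormed_fspace
begin

lemma bounded_into_add:
  assumes "bounded_into Y A f" "bounded_into Y A g"
  shows "bounded_into Y A (\<lambda>z t. f z t + g z t)"
proof -
  obtain C D where *: "\<And>z. z \<in> A \<Longrightarrow> f z \<in> elts Y \<and> nrm Y (f z) \<le> C"
    "\<And>z. z \<in> A \<Longrightarrow> g z \<in> elts Y \<and> nrm Y (g z) \<le> D"
    using assms unfolding bounded_into_iff by metis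
  have "nrm Y (\<lambda>t. f z t + g z t) \<le> C + D" if "z \<in> A" for z
    using nrm_add_le[of "f z" "g z"] *[OF that] by linarith
  then show ?thesis using * unfolding bounded_into_iff by (blast intro: add_closed)
qed

lemma bounded_into_mult:
  assumes "bounded_into Y A g" "\<And>z. z \<in> A \<Longrightarrow> cmod (\<psi> z) \<le> D"
  shows "bounded_into Y A (\<lambda>z t. \<psi> z * g z t)"
proof -
  obtain C where *: "\<And>z. z \<in> A \<Longrightarrow> g z \<in> elts Y \<and> nrm Y (g z) \<le> C"
    using assms(1) unfolding bounded_into_iff by metis
  have "nrm Y (\<lambda>t. \<psi> z * g z t) \<le> D * C" if "z \<in> A" for z
    using *[OF that] nrm_nonneg assms(2)[OF that]
    by (auto simp: nrm_scale intro!: mult_mono intro: order_trans[OF norm_ge_zero])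
  then show ?thesis using * unfolding bounded_into_iff by (blast intro: scale_closed)
qed

lemma continuous_into_add:
  assumes f: "continuous_into Y A f" and g: "continuous_into Y A g"
  shows "continuous_into Y A (\<lambda>z t. f z t + g z t)"
  unfolding continuous_into_def
proof (intro conjI ballI)
  have el: "f z \<in> elts Y" "g z \<in> elts Y" if "z \<in> A" for z
    using assms that by (auto simp: continuous_into_def)
  fix z assume z: "z \<in> A"
  show "(\<lambda>t. f z t + g z t) \<in> elts Y" using el z by (blast intro: add_closed)
  have ev: "\<forall>\<^sub>F w in at z within A. w \<in> A" by (simp add: eventually_at_filter)
  show "((\<lambda>w. nrm Y (\<lambda>t. f w t + g w t - (f z t + g z t))) \<longlongrightarrow> 0) (at z within A)"
  proof (rule tendsto_sandwich[OF _ _ tendsto_const])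
    show "((\<lambda>w. nrm Y (\<lambda>t. f w t - f z t) + nrm Y (\<lambda>t. g w t - g z t)) \<longlongrightarrow> 0) (at z within A)"
      using f g z by (auto simp: continuous_into_def intro!: tendsto_add_zero)
    show "\<forall>\<^sub>F w in at z within A. 0 \<le> nrm Y (\<lambda>t. f w t + g w t - (f z t + g z t))"
      using ev by eventually_elim (use el z in \<open>auto intro!: nrm_nonneg closed\<close>)
    show "\<forall>\<^sub>F w in at z within A. nrm Y (\<lambda>t. f w t + g w t - (f z t + g z t))
        \<le> nrm Y (\<lambda>t. f w t - f z t) + nrm Y (\<lambda>t. g w t - g z t)"
      using ev
    proof eventually_elim
      case (elim w)
      have "(\<lambda>t. f w t + g w t - (f z t + g z t)) = (\<lambda>t. (f w t - f z t) + (g w t - g z t))"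
        by (simp add: fun_eq_iff)
      then show ?case using el elim z by (simp only:) (intro nrm_add_le closed; blast)
    qed
  qed
qed

lemma continuous_into_mult:
  assumes g: "continuous_into Y A g" and \<psi>: "continuous_on A \<psi>"
  shows "continuous_into Y A (\<lambda>z t. \<psi> z * g z t)"
  unfolding continuous_into_def
proof (intro conjI ballI)
  have el: "g z \<in> elts Y" if "z \<in> A" for z
    using assms that by (auto simp: continuous_into_def)
  fix z assume z: "z \<in> A"
  show "(\<lambda>t. \<psi> z * g z t) \<in> elts Y" using el z by (blast intro: scale_closed)
  have ev: "\<forall>\<^sub>F w in at z within A. w \<in> A" by (simp add: eventually_at_filter)
  have lim: "(\<psi> \<longlongrightarrow> \<psi> z) (at z within A)" using \<psi> z by (simp add: continuous_on_def)
  show "((\<lambda>w. nrm Y (\<lambda>t. \<psi> w * g w t - \<psi> z * g z t)) \<longlongrightarrow> 0) (at z within A)"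
  proof (rule tendsto_sandwich[OF _ _ tendsto_const])
    have "((\<lambda>w. cmod (\<psi> w) * nrm Y (\<lambda>t. g w t - g z t) + cmod (\<psi> w - \<psi> z) * nrm Y (g z))
        \<longlongrightarrow> cmod (\<psi> z) * 0 + cmod (\<psi> z - \<psi> z) * nrm Y (g z)) (at z within A)"
      using g z by (intro tendsto_intros lim) (auto simp: continuous_into_def)
    then show "((\<lambda>w. cmod (\<psi> w) * nrm Y (\<lambda>t. g w t - g z t) + cmod (\<psi> w - \<psi> z) * nrm Y (g z))
        \<longlongrightarrow> 0) (at z within A)" by simp
    show "\<forall>\<^sub>F w in at z within A. 0 \<le> nrm Y (\<lambda>t. \<psi> w * g w t - \<psi> z * g z t)"
      using ev by eventually_elim (use el z in \<open>auto intro!: nrm_nonneg closed\<close>)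
    show "\<forall>\<^sub>F w in at z within A. nrm Y (\<lambda>t. \<psi> w * g w t - \<psi> z * g z t)
        \<le> cmod (\<psi> w) * nrm Y (\<lambda>t. g w t - g z t) + cmod (\<psi> w - \<psi> z) * nrm Y (g z)"
      using ev
    proof eventually_elim
      case (elim w)
      have "(\<lambda>t. \<psi> w * g w t - \<psi> z * g z t) = (\<lambda>t. \<psi> w * (g w t - g z t) + (\<psi> w - \<psi> z) * g z t)"
        by (simp add: fun_eq_iff algebra_simps)
      moreover have "(\<lambda>t. g w t - g z t) \<in> elts Y" using el elim z by (intro closed) auto
      ultimately show ?case
        using nrm_add_le[of "\<lambda>t. \<psi> w * (g w t - g z t)" "\<lambda>t. (\<psi> w - \<psi> z) * g z t"] el[OF z]
        by (simp add: nrm_scale scale_closed)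
    qed
  qed
qed

text \<open>The neighbourhood \<open>U\<close> is where the values are known to be elements of the
  space; the seminorm laws say nothing about difference quotients formed outside
  \<open>elts Y\<close>.\<close>

lemma has_deriv_into_add:
  assumes f: "has_deriv_into Y f z d" "\<And>w. w \<in> U \<Longrightarrow> f w \<in> elts Y"
    and g: "has_deriv_into Y g z e" "\<And>w. w \<in> U \<Longrightarrow> g w \<in> elts Y"
    and U: "open U" "z \<in> U"
  shows "has_deriv_into Y (\<lambda>w t. f w t + g w t) z (\<lambda>t. d t + e t)"
  unfolding has_deriv_into_def
proof
  have de: "d \<in> elts Y" "e \<in> elts Y" using f g by (auto simp: has_deriv_into_def)
  then show "(\<lambda>t. d t + e t) \<in> elts Y" by (intro closed)
  have ev: "\<forall>\<^sub>F w in at z. w \<in> U - {z}" using U by (rule eventually_at_in_open)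
  let ?Q = "\<lambda>f d w t. (f w t - f z t) / (w - z) - d t"
  have eq: "?Q (\<lambda>w t. f w t + g w t) (\<lambda>t. d t + e t) w = (\<lambda>t. ?Q f d w t + ?Q g e w t)" for w
    by (simp add: fun_eq_iff diff_divide_distrib add_divide_distrib)
  have Q: "?Q f d w \<in> elts Y" "?Q g e w \<in> elts Y" if "w \<in> U - {z}" for w
    using that U f(2) g(2) de by (auto intro!: closed)
  show "((\<lambda>w. nrm Y (?Q (\<lambda>w t. f w t + g w t) (\<lambda>t. d t + e t) w)) \<longlongrightarrow> 0) (at z)"
    unfolding eq
  proof (rule tendsto_sandwich[OF _ _ tendsto_const])
    show "((\<lambda>w. nrm Y (?Q f d w) + nrm Y (?Q g e w)) \<longlongrightarrow> 0) (at z)"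
      using f(1) g(1) by (auto simp: has_deriv_into_def intro: tendsto_add_zero)
    show "\<forall>\<^sub>F w in at z. 0 \<le> nrm Y (\<lambda>t. ?Q f d w t + ?Q g e w t)"
      using ev by eventually_elim (intro nrm_nonneg closed(2) Q)
    show "\<forall>\<^sub>F w in at z. nrm Y (\<lambda>t. ?Q f d w t + ?Q g e w t) \<le> nrm Y (?Q f d w) + nrm Y (?Q g e w)"
      using ev by eventually_elim (intro nrm_add_le Q)
  qed
qed

lemma has_deriv_into_mult:
  assumes g: "has_deriv_into Y g z d" "\<And>w. w \<in> U \<Longrightarrow> g w \<in> elts Y"
    and \<psi>: "(\<psi> has_field_derivative \<psi>') (at z)"
    and U: "open U" "z \<in> U"
  shows "has_deriv_into Y (\<lambda>w t. \<psi> w * g w t) z (\<lambda>t. \<psi> z * d t + \<psi>' * g z t)"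
  unfolding has_deriv_into_def
proof
  have d: "d \<in> elts Y" using g by (auto simp: has_deriv_into_def)
  have gz: "g z \<in> elts Y" using g U by auto
  show "(\<lambda>t. \<psi> z * d t + \<psi>' * g z t) \<in> elts Y" using d gz by (intro closed)
  have ev: "\<forall>\<^sub>F w in at z. w \<in> U - {z}" using U by (rule eventually_at_in_open)
  let ?Q = "\<lambda>w t. (g w t - g z t) / (w - z) - d t"
  let ?q = "\<lambda>w. (\<psi> w - \<psi> z) / (w - z)"
  have Q: "?Q w \<in> elts Y" if "w \<in> U - {z}" for w
    using that g(2) gz d by (auto intro!: closed)
  let ?E = "\<lambda>w t. (\<psi> w * g w t - \<psi> z * g z t) / (w - z) - (\<psi> z * d t + \<psi>' * g z t)"
  \<comment> \<open>The three errors of the product rule; each is a scalar times a vector, one of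
    which tends to 0 while the other stays bounded.\<close>
  have E: "?E w = (\<lambda>t. \<psi> w * ?Q w t + ((\<psi> w - \<psi> z) * d t + (?q w - \<psi>') * g z t))" if "w \<in> U - {z}" for w
    using that by (auto simp: fun_eq_iff divide_simps) (simp add: algebra_simps)
  have lim: "(\<psi> \<longlongrightarrow> \<psi> z) (at z)" "(?q \<longlongrightarrow> \<psi>') (at z)"
    using DERIV_isCont[OF \<psi>] \<psi> by (auto simp: isCont_def has_field_derivative_iff)
  show "((\<lambda>w. nrm Y (?E w)) \<longlongrightarrow> 0) (at z)"
  proof (rule tendsto_sandwich[OF _ _ tendsto_const])
    let ?b = "\<lambda>w. cmod (\<psi> w) * nrm Y (?Q w) + (cmod (\<psi> w - \<psi> z) * nrm Y d + cmod (?q w - \<psi>') * nrm Y (g z))"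
    have "(?b \<longlongrightarrow> cmod (\<psi> z) * 0 + (cmod (\<psi> z - \<psi> z) * nrm Y d + cmod (\<psi>' - \<psi>') * nrm Y (g z))) (at z)"
      using g(1) by (intro tendsto_intros lim) (auto simp: has_deriv_into_def)
    then show "(?b \<longlongrightarrow> 0) (at z)" by simp
    show "\<forall>\<^sub>F w in at z. 0 \<le> nrm Y (?E w)"
      using ev by eventually_elim (use g(2) gz d in \<open>auto intro!: nrm_nonneg closed\<close>)
    show "\<forall>\<^sub>F w in at z. nrm Y (?E w) \<le> ?b w"
      using ev
    proof eventually_elim
      case (elim w)
      have 1: "(\<lambda>t. \<psi> w * ?Q w t) \<in> elts Y" "(\<lambda>t. (\<psi> w - \<psi> z) * d t) \<in> elts Y"
        "(\<lambda>t. (?q w - \<psi>') * g z t) \<in> elts Y"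
        using Q[OF elim] d gz by (auto intro!: scale_closed)
      show ?case
        unfolding E[OF elim]
        using nrm_add_le[OF 1(1) add_closed[OF 1(2,3)]] nrm_add_le[OF 1(2,3)]
          nrm_scale[OF Q[OF elim], of "\<psi> w"] nrm_scale[OF d, of "\<psi> w - \<psi> z"] nrm_scale[OF gz, of "?q w - \<psi>'"]
        by linarith
    qed
  qed
qed

text \<open>The difference d - e is a difference of two quotient errors, both of which tend to 0 in
  norm. The conclusion is what allows one derivative to replace another inside a limit of
  norms.\<close>

lemma has_deriv_into_unique:
  assumes d: "has_deriv_into Y g z d" and e: "has_deriv_into Y g z e"
    and g: "\<And>w. w \<in> U \<Longrightarrow> g w \<in> elts Y" and U: "open U" "z \<in> U"
  shows "nrm Y (\<lambda>t. d t - e t) = 0"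
proof -
  have de: "d \<in> elts Y" "e \<in> elts Y" using d e by (auto simp: has_deriv_into_def)
  have ev: "\<forall>\<^sub>F w in at z. w \<in> U - {z}" using U by (rule eventually_at_in_open)
  let ?Q = "\<lambda>d w t. (g w t - g z t) / (w - z) - d t"
  have "nrm Y (\<lambda>t. d t - e t) \<le> 0"
  proof (rule tendsto_lowerbound)
    show "((\<lambda>w. nrm Y (?Q e w) + nrm Y (?Q d w)) \<longlongrightarrow> 0) (at z)"
      using d e by (auto simp: has_deriv_into_def intro: tendsto_add_zero)
    show "\<forall>\<^sub>F w in at z. nrm Y (\<lambda>t. d t - e t) \<le> nrm Y (?Q e w) + nrm Y (?Q d w)"
      using ev
    proof eventually_elim
      case (elim w)
      then have "?Q e w \<in> elts Y" "?Q d w \<in> elts Y" using de g U by (auto intro!: closed)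
      from nrm_diff_le[OF this] show ?case by simp
    qed
  qed simp
  then show ?thesis using nrm_nonneg[OF diff_closed[OF de]] by simp
qed

text \<open>Division by w - z shifts the coefficients. The value at the center may be any derivative
  \<open>d\<close>, since it differs from \<open>c 1\<close> by a function of norm 0 and convergence
  in norm cannot tell them apart. This freedom lets the quotient take at \<theta> a value built from
  \<open>centralizer\<close>.\<close>

lemma has_power_series_divide:
  assumes g: "has_power_series Y g z r c" and r: "r > 0" and gz: "nrm Y (g z) = 0"
    and d: "has_deriv_into Y g z d"
  shows "has_power_series Y (\<lambda>w. if w = z then d else (\<lambda>t. g w t / (w - z))) z r (\<lambda>k. c (Suc k))"
  unfolding has_power_series_def
proof (intro conjI allI ballI)
  have c: "c k \<in> elts Y" for k using g by (simp add: has_power_series_def)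
  have gel: "g w \<in> elts Y" if "w \<in> ball z r" for w using g that by (simp add: has_power_series_def)
  have gzel: "g z \<in> elts Y" using gel r by simp
  have del: "d \<in> elts Y" using d by (simp add: has_deriv_into_def)
  show "c (Suc k) \<in> elts Y" for k by (rule c)
  fix w assume w: "w \<in> ball z r"
  let ?L = "\<lambda>w. if w = z then d else (\<lambda>t. g w t / (w - z))"
  show L: "?L w \<in> elts Y" using del gel[OF w] by (auto intro: closed)
  show "(\<lambda>N. nrm Y (\<lambda>t. ?L w t - (\<Sum>k<N. (w - z) ^ k * c (Suc k) t))) \<longlonglongrightarrow> 0"
  proof (cases "w = z")
    case True
    have "nrm Y (\<lambda>t. d t - c 1 t) = 0"
      by (rule has_deriv_into_unique[OF d has_power_series_imp_deriv[OF g r], where U = "ball z r"]) (use r gel in auto)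
    \<comment> \<open>At the center only the empty partial sum fails to reduce to
      \<open>c 1\<close>, hence the shift to \<open>Suc N\<close>.\<close>
    then have "(\<lambda>N. nrm Y (\<lambda>t. ?L w t - (\<Sum>k<Suc N. (w - z) ^ k * c (Suc k) t))) \<longlonglongrightarrow> 0"
      using True by (simp add: sum.lessThan_Suc_shift del: sum.lessThan_Suc)
    then show ?thesis by (rule LIMSEQ_imp_Suc)
  next
    case False
    define u where "u = w - z"
    define R where "R = (\<lambda>N t. g w t - (\<Sum>k<N. u ^ k * c k t))"
    have R: "R N \<in> elts Y" for N using c gel[OF w] by (auto simp: R_def intro!: closed)
    have u: "u \<noteq> 0" using False by (simp add: u_def)
    have R0: "(\<lambda>N. nrm Y (R (Suc N))) \<longlonglongrightarrow> 0"
      using g w by (intro LIMSEQ_Suc) (simp add: has_power_series_def R_def u_def)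
    \<comment> \<open>Since g(z) vanishes only in norm, \<open>c 0\<close> need not be the zero
      function; it survives below as the term \<open>c 0 t / u\<close>, which has norm 0.\<close>
    have c0: "nrm Y (c 0) = 0"
    proof -
      have "nrm Y (c 0) \<le> nrm Y (g z) + nrm Y (\<lambda>t. g z t - c 0 t)"
        using nrm_diff_le[OF gzel diff_closed[OF gzel c[of 0]]] by simp
      then show ?thesis using power_series_at_center[OF g r] gz nrm_nonneg[OF c[of 0]] by simp
    qed
    have "(\<lambda>t. ?L w t - (\<Sum>k<N. (w - z) ^ k * c (Suc k) t)) = (\<lambda>t. R (Suc N) t / u + c 0 t / u)" for N
      using False u unfolding u_def[symmetric] R_def
      by (simp add: fun_eq_iff sum.lessThan_Suc_shift field_simps sum_distrib_left del: sum.lessThan_Suc)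
    moreover have "nrm Y (\<lambda>t. R (Suc N) t / u + c 0 t / u) \<le> nrm Y (R (Suc N)) / cmod u" for N
      using nrm_add_le[OF divide_closed[OF R[of "Suc N"], of u] divide_closed[OF c[of 0], of u]]
      by (simp add: nrm_divide R c c0)
    ultimately have le: "nrm Y (\<lambda>t. ?L w t - (\<Sum>k<N. (w - z) ^ k * c (Suc k) t)) \<le> nrm Y (R (Suc N)) / cmod u" for N
      by simp
    have "(\<lambda>N. nrm Y (R (Suc N)) / cmod u) \<longlonglongrightarrow> 0"
      using R0 by (rule tendsto_divide_zero)
    then show ?thesis
    proof (rule tendsto_sandwich[OF _ _ tendsto_const, rotated -1])
      show "\<forall>\<^sub>F N in sequentially. 0 \<le> nrm Y (\<lambda>t. ?L w t - (\<Sum>k<N. (w - z) ^ k * c (Suc k) t))"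
        using L c by (intro always_eventually allI nrm_nonneg diff_closed sum_closed scale_closed)
    qed (intro always_eventually allI le)
  qed
qed

end

section \<open>The strip and its boundary\<close>

lemma interior_strip: "interior strip = {z. 0 < Re z \<and> Re z < 1}"
proof -
  \<comment> \<open>As \<open>1 \<bullet> z\<close> is Re z, this presents the strip as an
    intersection of two half-spaces, whose interiors are known.\<close>
  have "strip = {z. 0 \<le> 1 \<bullet> z} \<inter> {z. 1 \<bullet> z \<le> (1::real)}"
    by (auto simp: strip_def inner_complex_def)
  moreover have "interior ({z::complex. 0 \<le> 1 \<bullet> z} \<inter> {z. 1 \<bullet> z \<le> (1::real)}) =
      {z. 0 < 1 \<bullet> z} \<inter> {z. 1 \<bullet> z < (1::real)}"
    by (simp only: interior_Int interior_halfspace_ge interior_halfspace_le one_neq_zero not_False_eq_True)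
  ultimately have "interior strip = {z. 0 < 1 \<bullet> z} \<inter> {z. 1 \<bullet> z < (1::real)}"
    by (simp only:)
  then show ?thesis by (auto simp: inner_complex_def)
qed

lemma frontier_strip: "frontier strip = {z. Re z = 0 \<or> Re z = 1}"
proof -
  have "closed strip"
    unfolding strip_def by (intro closed_Collect_conj closed_Collect_le continuous_intros)
  then show ?thesis unfolding frontier_def interior_strip by (auto simp: strip_def)
qed

section \<open>Closure properties of the Calderon space\<close>

locale couple =
  fixes X0 X1 :: "'a fspace"
  assumes admissible: "admissible_couple X0 X1"
begin

sublocale X0: seminormed_fspace X0
  using admissible by (auto simp: admissible_couple_def intro: kothe_seminormed)

sublocale X1: seminormed_fspace X1
  using admissible by (auto simp: admissible_couple_def intro: kothe_seminormed)

abbreviation "\<Sigma> \<equiv> sum_space X0 X1"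

sublocale \<Sigma>: seminormed_fspace \<Sigma>
  by (rule sum_space_seminormed[OF admissible])

abbreviation "\<H> \<equiv> calderon X0 X1"

lemma calderonD:
  assumes "g \<in> \<H>"
  shows "z \<in> strip \<Longrightarrow> g z \<in> elts \<Sigma>"
    and "g (Complex 0 s) \<in> elts X0" and "g (Complex 1 s) \<in> elts X1"
    and "analytic_into \<Sigma> (interior strip) g"
  using assms by (auto simp: calderon_def bounded_into_def)

lemma calderon_zero: "(\<lambda>_ _. 0) \<in> \<H>"
proof -
  have "has_power_series \<Sigma> (\<lambda>_ _. 0) z r (\<lambda>_ _. 0)" for z r
    by (simp add: has_power_series_def \<Sigma>.zero_closed \<Sigma>.nrm_zero)
  then have "analytic_into \<Sigma> (interior strip) (\<lambda>_ _. 0)"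
    unfolding analytic_into_iff using open_contains_ball[of "interior strip"] by blast
  then show ?thesis
    by (auto simp: calderon_def bounded_into_iff continuous_into_def \<Sigma>.zero_closed \<Sigma>.nrm_zero
      X0.zero_closed X0.nrm_zero X1.zero_closed X1.nrm_zero)
qed

lemma calderon_add:
  "f \<in> \<H> \<Longrightarrow> g \<in> \<H> \<Longrightarrow> (\<lambda>z t. f z t + g z t) \<in> \<H>"
  unfolding calderon_def mem_Collect_eq
  by (intro conjI \<Sigma>.bounded_into_add \<Sigma>.continuous_into_add \<Sigma>.analytic_into_add
      X0.bounded_into_add X0.continuous_into_add X1.bounded_into_add X1.continuous_into_add; blast)

lemma calderon_mult:
  assumes g: "g \<in> \<H>" and hol: "\<psi> holomorphic_on interior strip" and cont: "continuous_on strip \<psi>"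
    and bdd: "\<And>z. z \<in> strip \<Longrightarrow> cmod (\<psi> z) \<le> C"
  shows "(\<lambda>z t. \<psi> z * g z t) \<in> \<H>"
proof -
  have line: "continuous_on UNIV (\<lambda>s. \<psi> (Complex a s))" if "a = 0 \<or> a = 1" for a
    by (rule continuous_on_compose2[OF cont]) (use that in \<open>auto simp: strip_def intro!: continuous_intros\<close>)
  have line': "cmod (\<psi> (Complex a s)) \<le> C" if "a = 0 \<or> a = 1" for a s
    using that by (intro bdd) (auto simp: strip_def)
  have "analytic_into \<Sigma> (interior strip) (\<lambda>z t. \<psi> z * g z t)"
    unfolding analytic_into_iff
    using \<Sigma>.analytic_into_mult[OF hol open_interior calderonD(4)[OF g]] by auto
  then show ?thesis
    using g line line' bdd unfolding calderon_def mem_Collect_eq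
    by (intro conjI \<Sigma>.bounded_into_mult[where D = C] \<Sigma>.continuous_into_mult cont
      X0.bounded_into_mult[where D = C] X0.continuous_into_mult
      X1.bounded_into_mult[where D = C] X1.continuous_into_mult) auto
qed

lemma calderon_fsum:
  "(\<And>x. x \<in> set xs \<Longrightarrow> B x \<in> \<H>) \<Longrightarrow> (\<lambda>z. fsum (map (\<lambda>x. B x z) xs)) \<in> \<H>"
proof (induction xs)
  case Nil
  then show ?case using calderon_zero by (simp add: fsum_def)
next
  case (Cons x xs)
  then have "(\<lambda>z t. B x z t + fsum (map (\<lambda>x. B x z) xs) t) \<in> \<H>"
    by (intro calderon_add) auto
  then show ?case by (simp add: fsum_def)
qed

lemma calderon_has_deriv:
  assumes "g \<in> \<H>" "z \<in> interior strip"
  shows "\<exists>d. has_deriv_into \<Sigma> g z d"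
  using calderonD(4)[OF assms(1)] assms(2) \<Sigma>.has_power_series_imp_deriv
  unfolding analytic_into_iff by blast

lemma calderon_deriv_fsum:
  assumes "\<And>x. x \<in> set xs \<Longrightarrow> B x \<in> \<H>" "z \<in> interior strip"
    and "\<And>x. x \<in> set xs \<Longrightarrow> has_deriv_into \<Sigma> (B x) z (D x)"
  shows "has_deriv_into \<Sigma> (\<lambda>w. fsum (map (\<lambda>x. B x w) xs)) z (fsum (map D xs))"
  using assms(1,3)
proof (induction xs)
  case Nil
  then show ?case by (simp add: fsum_def has_deriv_into_def \<Sigma>.zero_closed \<Sigma>.nrm_zero)
next
  case (Cons x xs)
  have "has_deriv_into \<Sigma> (\<lambda>w t. B x w t + fsum (map (\<lambda>x. B x w) xs) t) z (\<lambda>t. D x t + fsum (map D xs) t)"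
  proof (rule \<Sigma>.has_deriv_into_add[where U = "interior strip"])
    show "B x w \<in> elts \<Sigma>" "fsum (map (\<lambda>x. B x w) xs) \<in> elts \<Sigma>" if "w \<in> interior strip" for w
      using that calderonD(1)[OF Cons.prems(1)[of x], of w] interior_subset[of strip]
        calderonD(1)[OF calderon_fsum[of xs B], of w] Cons.prems(1) by auto
  qed (use Cons assms(2) in auto)
  then show ?case by (simp add: fsum_def)
qed

text \<open>Removal of the singularity. At \<theta> continuity says that \<open>d\<close> is the
  derivative of \<open>K\<close>, and the power series is the shifted one; elsewhere L is K times
  the holomorphic factor 1 / (z - \<theta>), which is bounded away from \<theta> and in particular
  on the two boundary lines.\<close>

lemma calderon_divide:
  assumes K: "K \<in> \<H>" and \<theta>: "\<theta> \<in> interior strip" and K0: "nrm \<Sigma> (K \<theta>) = 0"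
    and d: "has_deriv_into \<Sigma> K \<theta> d"
  shows "(\<lambda>z. if z = \<theta> then d else (\<lambda>t. K z t / (z - \<theta>))) \<in> \<H>"
proof -
  define L where "L = (\<lambda>z. if z = \<theta> then d else (\<lambda>t. K z t / (z - \<theta>)))"
  have \<theta>s: "\<theta> \<in> strip" using \<theta> interior_subset by auto
  have del: "d \<in> elts \<Sigma>" using d by (simp add: has_deriv_into_def)
  note Kel = calderonD(1)[OF K]
  have Lel: "L z \<in> elts \<Sigma>" if "z \<in> strip" for z
    using Kel[OF that] del by (auto simp: L_def intro: \<Sigma>.divide_closed)
  have cont: "((\<lambda>w. nrm \<Sigma> (\<lambda>t. L w t - L z t)) \<longlongrightarrow> 0) (at z within strip)" if z: "z \<in> strip" for z
  proof (cases "z = \<theta>")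
    case True
    have ev: "\<forall>\<^sub>F w in at z within strip. w \<in> strip - {z}" by (simp add: eventually_at_filter)
    have "((\<lambda>w. nrm \<Sigma> (\<lambda>t. (K w t - K z t) / (w - z) - d t)) \<longlongrightarrow> 0) (at z within strip)"
      using d True by (auto simp: has_deriv_into_def intro: tendsto_mono[OF at_le[OF subset_UNIV]])
    then show ?thesis
    proof (rule tendsto_sandwich[OF _ _ tendsto_const, rotated -1])
      show "\<forall>\<^sub>F w in at z within strip. 0 \<le> nrm \<Sigma> (\<lambda>t. L w t - L z t)"
        using ev by eventually_elim (use Lel z in \<open>auto intro!: \<Sigma>.nrm_nonneg \<Sigma>.diff_closed\<close>)
      show "\<forall>\<^sub>F w in at z within strip. nrm \<Sigma> (\<lambda>t. L w t - L z t)
          \<le> nrm \<Sigma> (\<lambda>t. (K w t - K z t) / (w - z) - d t)"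
        using ev
      proof eventually_elim
        case (elim w)
        have 1: "(\<lambda>t. (K w t - K z t) / (w - z) - d t) \<in> elts \<Sigma>" and 2: "(\<lambda>t. K z t / (w - z)) \<in> elts \<Sigma>"
          using Kel elim z del by (auto intro!: \<Sigma>.closed)
        \<comment> \<open>The correction \<open>K z t / (w - z)\<close> appears because K(\<theta>)
          is zero only in norm; it has norm 0.\<close>
        have "(\<lambda>t. L w t - L z t) = (\<lambda>t. ((K w t - K z t) / (w - z) - d t) + K z t / (w - z))"
          using True elim by (auto simp: L_def fun_eq_iff diff_divide_distrib)
        then show ?case using \<Sigma>.nrm_add_le[OF 1 2] \<Sigma>.nrm_divide[OF Kel[OF z]] K0 True by simp
      qed
    qed
  next
    case False
    have "continuous_into \<Sigma> (strip - {\<theta>}) K"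
    proof -
      have "continuous_into \<Sigma> strip K" using K by (simp add: calderon_def)
      then show ?thesis
        by (auto simp: continuous_into_def intro: tendsto_mono[OF at_le[OF Diff_subset]])
    qed
    then have "continuous_into \<Sigma> (strip - {\<theta>}) (\<lambda>w t. 1 / (w - \<theta>) * K w t)"
      by (rule \<Sigma>.continuous_into_mult) (auto intro!: continuous_intros)
    then have "((\<lambda>w. nrm \<Sigma> (\<lambda>t. 1 / (w - \<theta>) * K w t - 1 / (z - \<theta>) * K z t)) \<longlongrightarrow> 0) (at z within strip - {\<theta>})"
      using z False unfolding continuous_into_def by blast
    \<comment> \<open>Continuity at z \<noteq> \<theta> is local, so removing the point \<theta>
      from the strip does not change the filter.\<close>
    also have "at z within strip - {\<theta>} = at z within strip"
      using False by (intro at_within_nhd[of z "- {\<theta>}"]) auto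
    finally show ?thesis
    proof (rule Lim_transform_eventually)
      have "\<forall>\<^sub>F w in at z within strip. w \<noteq> \<theta>"
        using False t1_space_nhds[of z \<theta>] by (auto simp: eventually_at_filter elim: eventually_mono)
      then show "\<forall>\<^sub>F w in at z within strip.
          nrm \<Sigma> (\<lambda>t. 1 / (w - \<theta>) * K w t - 1 / (z - \<theta>) * K z t) = nrm \<Sigma> (\<lambda>t. L w t - L z t)"
        by eventually_elim (use False in \<open>simp add: L_def\<close>)
    qed
  qed
  then have contL: "continuous_into \<Sigma> strip L" using Lel by (simp add: continuous_into_def)
  have "bounded_into \<Sigma> strip L"
  proof -
    have "\<forall>\<^sub>F w in at \<theta> within strip. nrm \<Sigma> (\<lambda>t. L w t - L \<theta> t) < 1"
      using cont[OF \<theta>s] by (rule order_tendstoD) simp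
    then obtain e where e: "e > 0"
      "\<And>w. w \<in> strip \<Longrightarrow> w \<noteq> \<theta> \<Longrightarrow> dist w \<theta> < e \<Longrightarrow> nrm \<Sigma> (\<lambda>t. L w t - L \<theta> t) < 1"
      unfolding eventually_at by auto
    obtain C where C: "\<And>w. w \<in> strip \<Longrightarrow> nrm \<Sigma> (K w) \<le> C"
      using K unfolding calderon_def bounded_into_iff by blast
    have C0: "0 \<le> C" using C[OF \<theta>s] K0 by simp
    have "nrm \<Sigma> (L w) \<le> nrm \<Sigma> (L \<theta>) + 1 + C / e" if w: "w \<in> strip" for w
    proof -
      \<comment> \<open>Within distance \<open>e\<close> of \<theta> continuity keeps L within 1 of
        its value at \<theta>; farther away the division enlarges the bound \<open>C\<close> for K
        by at most the factor 1/e.\<close>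
      consider "w = \<theta>" | "w \<noteq> \<theta>" "dist w \<theta> < e" | "w \<noteq> \<theta>" "dist w \<theta> \<ge> e" by linarith
      then show ?thesis
      proof cases
        case 1
        then show ?thesis using C0 e(1) by (simp add: add_nonneg_nonneg)
      next
        case 2
        have "nrm \<Sigma> (L w) \<le> nrm \<Sigma> (\<lambda>t. L w t - L \<theta> t) + nrm \<Sigma> (L \<theta>)"
          using \<Sigma>.nrm_add_le[OF \<Sigma>.diff_closed[OF Lel[OF w] Lel[OF \<theta>s]] Lel[OF \<theta>s]] by simp
        moreover have "0 \<le> C / e" using C0 e(1) by simp
        ultimately show ?thesis using e(2)[OF w 2] by linarith
      next
        case 3
        then have "nrm \<Sigma> (L w) = nrm \<Sigma> (K w) / dist w \<theta>"
          using \<Sigma>.nrm_divide[OF Kel[OF w]] by (simp add: L_def dist_norm)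
        also have "\<dots> \<le> C / e" using C[OF w] C0 e(1) 3 by (intro frac_le) auto
        finally show ?thesis using \<Sigma>.nrm_nonneg[OF Lel[OF \<theta>s]] by simp
      qed
    qed
    then show ?thesis using Lel unfolding bounded_into_iff by blast
  qed
  moreover have "analytic_into \<Sigma> (interior strip) L"
    unfolding analytic_into_iff
  proof
    fix z assume z: "z \<in> interior strip"
    show "\<exists>r>0. \<exists>c. ball z r \<subseteq> interior strip \<and> has_power_series \<Sigma> L z r c"
    proof (cases "z = \<theta>")
      case True
      then obtain r c where "r > 0" "ball z r \<subseteq> interior strip" "has_power_series \<Sigma> K z r c"
        using calderonD(4)[OF K] \<theta> unfolding analytic_into_iff by blast
      then show ?thesis
        using \<Sigma>.has_power_series_divide[of K z r c d] K0 d True unfolding L_def by blast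
    next
      case False
      have "(\<lambda>w. 1 / (w - \<theta>)) holomorphic_on - {\<theta>}" by (auto intro!: holomorphic_intros)
      from \<Sigma>.analytic_into_mult[OF this _ calderonD(4)[OF K] z] False
      obtain r c where r: "r > 0" "ball z r \<subseteq> interior strip \<inter> - {\<theta>}"
        "has_power_series \<Sigma> (\<lambda>w t. 1 / (w - \<theta>) * K w t) z r c" by auto
      have "L w = (\<lambda>t. 1 / (w - \<theta>) * K w t)" if "w \<in> ball z r" for w
        using r(2) that by (auto simp: L_def)
      then have "has_power_series \<Sigma> L z r c"
        using r(3) unfolding has_power_series_def by simp
      then show ?thesis using r by blast
    qed
  qed
  moreover
  have line: "bounded_into X UNIV (\<lambda>s. L (Complex a s)) \<and> continuous_into X UNIV (\<lambda>s. L (Complex a s))"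
    if X: "seminormed_fspace X" and a: "a = 0 \<or> a = 1"
      and b: "bounded_into X UNIV (\<lambda>s. K (Complex a s))" and c: "continuous_into X UNIV (\<lambda>s. K (Complex a s))"
    for X a
  proof -
    interpret X: seminormed_fspace X by (rule X)
    have ne: "Complex a s \<noteq> \<theta>" for s using \<theta> a by (auto simp: interior_strip)
    \<comment> \<open>This is the distance from \<theta> to the vertical line with real part
      \<open>a\<close>.\<close>
    define e where "e = \<bar>Re \<theta> - a\<bar>"
    have e: "e > 0" using \<theta> a by (auto simp: e_def interior_strip)
    have "e \<le> cmod (Complex a s - \<theta>)" for s
      using abs_Re_le_cmod[of "Complex a s - \<theta>"] by (simp add: e_def)
    then have bd: "cmod (1 / (Complex a s - \<theta>)) \<le> 1 / e" for s
      using e by (simp add: norm_divide frac_le)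
    have L: "L (Complex a s) = (\<lambda>t. 1 / (Complex a s - \<theta>) * K (Complex a s) t)" for s
      using ne by (simp add: L_def)
    have "continuous_on UNIV (\<lambda>s. 1 / (Complex a s - \<theta>))"
      using ne by (auto intro!: continuous_intros)
    then show ?thesis
      unfolding L
      by (intro conjI X.bounded_into_mult[OF b, where D = "1 / e"] X.continuous_into_mult[OF c] bd)
  qed
  have "bounded_into X0 UNIV (\<lambda>s. L (Complex 0 s)) \<and> continuous_into X0 UNIV (\<lambda>s. L (Complex 0 s))"
    using K by (intro line X0.seminormed_fspace_axioms) (auto simp: calderon_def)
  moreover have "bounded_into X1 UNIV (\<lambda>s. L (Complex 1 s)) \<and> continuous_into X1 UNIV (\<lambda>s. L (Complex 1 s))"
    using K by (intro line X1.seminormed_fspace_axioms) (auto simp: calderon_def)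
  ultimately have "L \<in> \<H>" using contL by (auto simp: calderon_def)
  then show ?thesis by (simp add: L_def)
qed

section \<open>The Calderon norm and the interpolation norm\<close>

lemma calderon_norm_le:
  assumes "\<And>s. nrm X0 (g (Complex 0 s)) \<le> C" "\<And>s. nrm X1 (g (Complex 1 s)) \<le> C"
  shows "calderon_norm X0 X1 g \<le> C"
  unfolding calderon_norm_def by (rule cSup_least) (use assms in auto)

lemma calderon_norm_ge:
  assumes g: "g \<in> \<H>"
  shows "nrm X0 (g (Complex 0 s)) \<le> calderon_norm X0 X1 g" "nrm X1 (g (Complex 1 s)) \<le> calderon_norm X0 X1 g"
proof -
  have "bdd_above (range (\<lambda>s. nrm X0 (g (Complex 0 s))) \<union> range (\<lambda>s. nrm X1 (g (Complex 1 s))))"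
    using g by (auto simp: calderon_def bounded_into_def)
  then show "nrm X0 (g (Complex 0 s)) \<le> calderon_norm X0 X1 g" "nrm X1 (g (Complex 1 s)) \<le> calderon_norm X0 X1 g"
    unfolding calderon_norm_def by (auto intro!: cSup_upper)
qed

lemma interp_memI:
  assumes g: "g \<in> \<H>" and f: "f \<in> borel_measurable (meas X0)" "AE t in meas X0. f t = g (of_real \<theta>) t"
  shows "f \<in> elts (interp X0 X1 \<theta>)"
  using assms by (auto simp: interp_def)

lemma interp_nrm_le:
  assumes g: "g \<in> \<H>" and f: "AE t in meas X0. f t = g (of_real \<theta>) t"
    and C: "calderon_norm X0 X1 g \<le> C"
  shows "nrm (interp X0 X1 \<theta>) f \<le> C"
proof -
  let ?S = "{calderon_norm X0 X1 g | g. g \<in> \<H> \<and> (AE t in meas X0. f t = g (of_real \<theta>) t)}"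
  have "0 \<le> calderon_norm X0 X1 h" if "h \<in> \<H>" for h
    using calderon_norm_ge(1)[OF that, of 0] X0.nrm_nonneg[OF calderonD(2)[OF that, of 0]] by linarith
  then have "bdd_below ?S" by (auto intro!: bdd_belowI[of _ 0])
  then have "Inf ?S \<le> calderon_norm X0 X1 g" using g f by (intro cInf_lower) auto
  then show ?thesis using C by (simp add: interp_def)
qed

end

section \<open>The estimate\<close>

text \<open>The triangle inequality bounds the defining set by the number of entries, so
  \<open>Sup\<close> is a genuine least upper bound. The predicate \<open>P\<close> stands for
  \<open>kothe\<close> or \<open>basis_space\<close>, so that one proof serves both kinds of
  classes.\<close>

lemma M_sup_upper:
  assumes S: "support_closed P S" and P: "\<And>X. P X \<Longrightarrow> kothe X" and Y: "P Y"
    and zs: "(Y, zs) \<in> S" "\<forall>z\<in>set zs. nrm Y z \<le> 1"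
  shows "nrm Y (fsum zs) \<le> M_sup S Y (length zs)"
proof -
  interpret Y: seminormed_fspace Y by (rule kothe_seminormed[OF P[OF Y]])
  let ?R = "{nrm Y (fsum xs) | xs. (Y, xs) \<in> S \<and> length xs = length zs \<and> (\<forall>x\<in>set xs. nrm Y x \<le> 1)}"
  have "nrm Y (fsum xs) \<le> length zs"
    if xs: "(Y, xs) \<in> S" "length xs = length zs" "\<forall>x\<in>set xs. nrm Y x \<le> 1" for xs
  proof -
    have "set xs \<subseteq> elts Y" using S xs(1) by (auto simp: support_closed_def)
    then have "nrm Y (fsum xs) \<le> (\<Sum>x\<leftarrow>xs. nrm Y x)" by (rule Y.nrm_fsum_le)
    also have "\<dots> \<le> (\<Sum>x\<leftarrow>xs. 1)" by (rule sum_list_mono) (use xs(3) in auto)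
    finally show ?thesis using xs(2) by (simp add: sum_list_triv)
  qed
  then have "bdd_above ?R" unfolding bdd_above_def by blast
  then show ?thesis unfolding M_sup_def using zs by (intro cSup_upper) auto
qed

text \<open>Divided by \<open>C\<close>, the vectors \<open>B x\<close> lie in the unit ball of
  \<open>Y\<close> and their supports are contained in those of the original family, so they form a
  family of the class over \<open>Y\<close>. This carries a family from the interpolation space to
  the endpoint spaces.\<close>

lemma support_closed_bound:
  assumes S: "support_closed P S" and P: "\<And>X. P X \<Longrightarrow> kothe X" and Y: "P Y" "meas Y = meas X"
    and xs: "(X, xs) \<in> S" and B: "\<And>x. x \<in> set xs \<Longrightarrow> B x \<in> elts Y \<and> nrm Y (B x) \<le> C \<and> supp_le (meas X) (B x) x"
    and C: "C > 0"
  shows "nrm Y (fsum (map B xs)) \<le> C * M_sup S Y (length xs)"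
proof -
  interpret Y: seminormed_fspace Y by (rule kothe_seminormed[OF P[OF Y(1)]])
  define zs where "zs = map (\<lambda>x t. B x t / of_real C) xs"
  have "(Y, zs) \<in> S"
  proof -
    have "set zs \<subseteq> elts Y" using B by (auto simp: zs_def intro!: Y.divide_closed)
    moreover have "supp_le (meas X) (zs ! i) (xs ! i)" if "i < length xs" for i
      using B[of "xs ! i"] that C by (auto simp: zs_def supp_le_def)
    ultimately show ?thesis
      using S xs Y length_map unfolding support_closed_def zs_def by blast
  qed
  moreover have "\<forall>z\<in>set zs. nrm Y z \<le> 1"
    using B C by (auto simp: zs_def Y.nrm_divide)
  ultimately have "nrm Y (fsum zs) \<le> M_sup S Y (length zs)"
    by (intro M_sup_upper[OF S P Y(1)])
  moreover have "fsum zs = (\<lambda>t. fsum (map B xs) t / of_real C)"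
    unfolding zs_def by (induction xs) (auto simp: fsum_def add_divide_distrib fun_eq_iff)
  moreover have "fsum (map B xs) \<in> elts Y" using B by (intro Y.fsum_closed) auto
  ultimately show ?thesis using C by (simp add: Y.nrm_divide zs_def field_simps)
qed

lemma fsum_cong_AE:
  assumes "\<And>x. x \<in> set xs \<Longrightarrow> AE t in M. f x t = g x t"
  shows "AE t in M. fsum (map f xs) t = fsum (map g xs) t"
  using assms
proof (induction xs)
  case (Cons x xs)
  then have "AE t in M. f x t = g x t" "AE t in M. fsum (map f xs) t = fsum (map g xs) t" by auto
  then show ?case by eventually_elim (simp add: fsum_def)
qed (auto simp: fsum_def)

section \<open>The bound for the defect\<close>

context couple
begin

text \<open>The power series at \<theta> provides a derivative, so the choice in
  \<open>centralizer\<close> yields an actual one.\<close>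

lemma centralizer_has_deriv:
  assumes "B x \<in> \<H>" "of_real \<theta> \<in> interior strip"
  shows "has_deriv_into \<Sigma> (B x) (of_real \<theta>) (centralizer X0 X1 \<theta> B x)"
  unfolding centralizer_def using calderon_has_deriv[OF assms] by (rule someI_ex)

text \<open>The arbitrary positive bounds \<open>a\<close> and \<open>b\<close> replace the suprema
  also inside the logarithm, so that the balancing factor exists even when a supremum is 0. The
  bound on the sum itself is listed as well: it is what settles that degenerate case.\<close>

lemma defect_bound:
  assumes \<theta>: "0 < \<theta>" "\<theta> < 1" and \<epsilon>: "0 < \<epsilon>" "\<epsilon> < 1 / 4"
    and S: "support_closed P S" and P: "\<And>X. P X \<Longrightarrow> kothe X" and PX: "P X0" "P X1"
    and B: "selector X0 X1 \<theta> \<epsilon> B"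
    and xs: "(interp X0 X1 \<theta>, xs) \<in> S" "\<forall>x\<in>set xs. nrm (interp X0 X1 \<theta>) x \<le> 1"
    and a: "M_sup S X0 (length xs) \<le> a" "0 < a" and b: "M_sup S X1 (length xs) \<le> b" "0 < b"
  defines "X \<equiv> interp X0 X1 \<theta>" and "E \<equiv> a powr (1 - \<theta>) * b powr \<theta>"
    and "\<Omega> \<equiv> centralizer X0 X1 \<theta> B"
    and "D \<equiv> (\<lambda>t. centralizer X0 X1 \<theta> B (fsum xs) t - (\<Sum>x\<leftarrow>xs. centralizer X0 X1 \<theta> B x t)
       - of_real (ln (a / b)) * fsum xs t)"
  shows "nrm X (fsum xs) \<le> (1 + \<epsilon>) * E"
    and "D \<in> elts X" and "nrm X D \<le> 3 * (E / infdist (of_real \<theta>) (frontier strip))"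
proof -
  let ?M = "meas X0" and ?\<theta> = "complex_of_real \<theta>"
  \<comment> \<open>That the interpolation space is a Koethe space is read off from its carrying a
    family of the class, all of whose spaces satisfy \<open>P\<close>.\<close>
  have PXi: "kothe X" and xsX: "set xs \<subseteq> elts X" using S xs(1) P by (auto simp: support_closed_def X_def)
  interpret X: seminormed_fspace X by (rule kothe_seminormed[OF PXi])
  have \<theta>i: "?\<theta> \<in> interior strip" and \<theta>s: "?\<theta> \<in> strip" using \<theta> unfolding interior_strip by (auto simp: strip_def)
  have meas: "meas X1 = ?M" using admissible by (simp add: admissible_couple_def)
  have E: "0 < E" using a b by (simp add: E_def)
  have B\<H>: "B x \<in> \<H>" and B\<theta>: "AE t in ?M. B x ?\<theta> t = x t"
    and Bn: "calderon_norm X0 X1 (B x) \<le> (1 + \<epsilon>) * nrm X x"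
    and Bs: "z \<in> strip \<Longrightarrow> supp_le ?M (B x z) x" if "x \<in> elts X" for x z
    using B that unfolding selector_def Let_def X_def by auto
  have \<Omega>': "has_deriv_into \<Sigma> (B x) ?\<theta> (\<Omega> x)" if "x \<in> elts X" for x
    unfolding \<Omega>_def by (intro centralizer_has_deriv B\<H> that \<theta>i)
  have line: "Complex 0 s \<in> strip" "Complex 1 s \<in> strip" for s by (auto simp: strip_def)

  define \<kappa> where "\<kappa> = ln (a / b)"
  \<comment> \<open>This is (a/b) to the power z - \<theta>, written as an exponential: it equals 1
    at \<theta> and has derivative \<open>\<kappa>\<close> there.\<close>
  define \<phi> where "\<phi> = (\<lambda>z. exp (of_real \<kappa> * (z - ?\<theta>)))"
  define G0 where "G0 = (\<lambda>z. fsum (map (\<lambda>x. B x z) xs))"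
  define G where "G = (\<lambda>z t. \<phi> z * G0 z t)"
  have B_le: "calderon_norm X0 X1 (B x) \<le> 1 + \<epsilon>" if "x \<in> set xs" for x
  proof -
    have "(1 + \<epsilon>) * nrm X x \<le> (1 + \<epsilon>) * 1"
      using xs(2) that \<epsilon> by (intro mult_left_mono) (auto simp: X_def)
    then show ?thesis using Bn[of x] that xsX by auto
  qed
  have G0_le0: "nrm X0 (G0 (Complex 0 s)) \<le> (1 + \<epsilon>) * a" for s
  proof -
    have "nrm X0 (fsum (map (\<lambda>x. B x (Complex 0 s)) xs)) \<le> (1 + \<epsilon>) * M_sup S X0 (length xs)"
    proof (rule support_closed_bound[OF S P PX(1) _ xs(1)])
      fix x assume x: "x \<in> set xs"
      then have xX: "x \<in> elts X" using xsX by auto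
      show "B x (Complex 0 s) \<in> elts X0 \<and> nrm X0 (B x (Complex 0 s)) \<le> 1 + \<epsilon> \<and>
          supp_le (meas (interp X0 X1 \<theta>)) (B x (Complex 0 s)) x"
        using calderonD(2)[OF B\<H>[OF xX]] calderon_norm_ge(1)[OF B\<H>[OF xX], of s] B_le[OF x] Bs[OF xX line(1)]
        by auto
    qed (use \<epsilon> in auto)
    also have "\<dots> \<le> (1 + \<epsilon>) * a" using a \<epsilon> by (intro mult_left_mono) auto
    finally show ?thesis by (simp add: G0_def)
  qed
  have G0_le1: "nrm X1 (G0 (Complex 1 s)) \<le> (1 + \<epsilon>) * b" for s
  proof -
    have "nrm X1 (fsum (map (\<lambda>x. B x (Complex 1 s)) xs)) \<le> (1 + \<epsilon>) * M_sup S X1 (length xs)"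
    proof (rule support_closed_bound[OF S P PX(2) _ xs(1)])
      fix x assume x: "x \<in> set xs"
      then have xX: "x \<in> elts X" using xsX by auto
      show "B x (Complex 1 s) \<in> elts X1 \<and> nrm X1 (B x (Complex 1 s)) \<le> 1 + \<epsilon> \<and>
          supp_le (meas (interp X0 X1 \<theta>)) (B x (Complex 1 s)) x"
        using calderonD(3)[OF B\<H>[OF xX]] calderon_norm_ge(2)[OF B\<H>[OF xX], of s] B_le[OF x] Bs[OF xX line(2)]
        by auto
    qed (use \<epsilon> meas in auto)
    also have "\<dots> \<le> (1 + \<epsilon>) * b" using b \<epsilon> by (intro mult_left_mono) auto
    finally show ?thesis by (simp add: G0_def)
  qed
  have G0\<H>: "G0 \<in> \<H>" unfolding G0_def using B\<H> xsX by (intro calderon_fsum) auto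
  have G\<H>: "G \<in> \<H>"
    unfolding G_def
  proof (rule calderon_mult[OF G0\<H>])
    show "\<phi> holomorphic_on interior strip" "continuous_on strip \<phi>"
      unfolding \<phi>_def by (intro holomorphic_intros continuous_intros)+
    show "cmod (\<phi> z) \<le> exp \<bar>\<kappa>\<bar>" if "z \<in> strip" for z
    proof -
      \<comment> \<open>The modulus of \<open>\<phi> z\<close> is exp (\<kappa> (Re z - \<theta>)),
        and both Re z and \<theta> lie between 0 and 1.\<close>
      have "\<bar>Re z - \<theta>\<bar> \<le> 1" using that \<theta> by (auto simp: strip_def)
      then have "\<bar>\<kappa> * (Re z - \<theta>)\<bar> \<le> \<bar>\<kappa>\<bar>" by (simp add: abs_mult mult_left_le)
      then show ?thesis by (auto simp: \<phi>_def)
    qed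
  qed
  have E_exp: "E = exp ((1 - \<theta>) * ln a + \<theta> * ln b)"
    using a b by (simp add: E_def powr_def exp_add)
  have \<kappa>_eq: "\<kappa> = ln a - ln b" using a b by (simp add: \<kappa>_def ln_div)
  \<comment> \<open>On the line Re z = 0 the factor has modulus (a/b)^(-\<theta>), on Re z = 1 it
    has modulus (a/b)^(1 - \<theta>); multiplied by a and b respectively, both give
    \<open>E\<close>.\<close>
  have \<phi>0: "cmod (\<phi> (Complex 0 s)) * a = E" for s
  proof -
    have "cmod (\<phi> (Complex 0 s)) * a = exp (- \<kappa> * \<theta>) * exp (ln a)" using a by (simp add: \<phi>_def)
    also have "\<dots> = E" unfolding E_exp \<kappa>_eq exp_add[symmetric] by (simp add: algebra_simps)
    finally show ?thesis .
  qed
  have \<phi>1: "cmod (\<phi> (Complex 1 s)) * b = E" for s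
  proof -
    have "cmod (\<phi> (Complex 1 s)) * b = exp (\<kappa> * (1 - \<theta>)) * exp (ln b)" using b by (simp add: \<phi>_def)
    also have "\<dots> = E" unfolding E_exp \<kappa>_eq exp_add[symmetric] by (simp add: algebra_simps)
    finally show ?thesis .
  qed
  have G_le0: "nrm X0 (G (Complex 0 s)) \<le> (1 + \<epsilon>) * E" for s
    using mult_left_mono[OF G0_le0[of s] norm_ge_zero[of "\<phi> (Complex 0 s)"]]
    by (simp add: G_def X0.nrm_scale calderonD(2)[OF G0\<H>] flip: \<phi>0[of s]) (simp add: mult_ac)
  have G_le1: "nrm X1 (G (Complex 1 s)) \<le> (1 + \<epsilon>) * E" for s
    using mult_left_mono[OF G0_le1[of s] norm_ge_zero[of "\<phi> (Complex 1 s)"]]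
    by (simp add: G_def X1.nrm_scale calderonD(3)[OF G0\<H>] flip: \<phi>1[of s]) (simp add: mult_ac)
  have G0\<theta>: "AE t in ?M. G0 ?\<theta> t = fsum xs t"
    using fsum_cong_AE[of xs "\<lambda>x. B x ?\<theta>" "\<lambda>x. x" ?M] B\<theta> xsX by (auto simp: G0_def)
  have \<phi>\<theta>: "\<phi> ?\<theta> = 1" by (simp add: \<phi>_def)
  have fX: "fsum xs \<in> elts X" by (rule X.fsum_closed[OF xsX])
  \<comment> \<open>\<open>G\<close> takes the value of the sum at \<theta> and so competes in the
    infimum defining the norm. Applying the selector to the sum costs a second factor 1 +
    \<epsilon>, whence the square in the bound for \<open>F\<close>.\<close>
  show fn: "nrm X (fsum xs) \<le> (1 + \<epsilon>) * E"
    unfolding X_def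
  proof (rule interp_nrm_le[OF G\<H>])
    show "AE t in ?M. fsum xs t = G ?\<theta> t"
      using G0\<theta> by eventually_elim (simp add: G_def \<phi>\<theta>)
    show "calderon_norm X0 X1 G \<le> (1 + \<epsilon>) * E" by (rule calderon_norm_le[OF G_le0 G_le1])
  qed

  define F where "F = B (fsum xs)"
  have F\<H>: "F \<in> \<H>" using B\<H>[OF fX] by (simp add: F_def)
  have F_le: "calderon_norm X0 X1 F \<le> (1 + \<epsilon>)\<^sup>2 * E"
  proof -
    have "(1 + \<epsilon>) * nrm X (fsum xs) \<le> (1 + \<epsilon>) * ((1 + \<epsilon>) * E)"
      using fn \<epsilon> by (intro mult_left_mono) auto
    then show ?thesis using Bn[OF fX] by (simp add: F_def power2_eq_square mult_ac)
  qed
  have F\<theta>: "AE t in ?M. F ?\<theta> t = fsum xs t" using B\<theta>[OF fX] by (simp add: F_def)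
  \<comment> \<open>The difference is written with the factor -1 so that the closure and derivative
    rules for sums and scalar multiples apply verbatim.\<close>
  define K where "K = (\<lambda>z t. F z t + (- 1) * G z t)"
  have K\<H>: "K \<in> \<H>"
    unfolding K_def by (intro calderon_add F\<H> calderon_mult[OF G\<H>, where C = 1]) auto
  have const: "(1 + \<epsilon>)\<^sup>2 * E + (1 + \<epsilon>) * E \<le> 3 * E"
  proof -
    have "(1 + \<epsilon>)\<^sup>2 \<le> (5/4)\<^sup>2" using \<epsilon> by (intro power_mono) auto
    then have "(1 + \<epsilon>)\<^sup>2 + (1 + \<epsilon>) \<le> 3" using \<epsilon> by (simp add: power2_eq_square)
    then show ?thesis using E by (simp flip: distrib_right)
  qed
  have K_le0: "nrm X0 (K (Complex 0 s)) \<le> 3 * E" for s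
    using X0.nrm_diff_le[OF calderonD(2)[OF F\<H>, of s] calderonD(2)[OF G\<H>, of s]]
      calderon_norm_ge(1)[OF F\<H>, of s] F_le G_le0[of s] const by (simp add: K_def)
  have K_le1: "nrm X1 (K (Complex 1 s)) \<le> 3 * E" for s
    using X1.nrm_diff_le[OF calderonD(3)[OF F\<H>, of s] calderonD(3)[OF G\<H>, of s]]
      calderon_norm_ge(2)[OF F\<H>, of s] F_le G_le1[of s] const by (simp add: K_def)
  have K\<theta>: "nrm \<Sigma> (K ?\<theta>) = 0"
  proof -
    have "AE t in ?M. K ?\<theta> t = 0"
      using G0\<theta> F\<theta> by eventually_elim (simp add: K_def G_def \<phi>\<theta>)
    then have "nrm \<Sigma> (K ?\<theta>) = nrm \<Sigma> (\<lambda>_. 0)"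
      using calderonD(1)[OF K\<H> \<theta>s] by (intro \<Sigma>.nrm_cong_AE) (auto simp only: \<Sigma>.zero_closed meas_sum_space)
    then show ?thesis by (simp add: \<Sigma>.nrm_zero)
  qed
  \<comment> \<open>The derivative of \<open>K\<close> by the product rule, with the representatives
    picked by \<open>\<Omega>\<close>. As \<phi>(\<theta>) = 1 and G0(\<theta>) is almost everywhere
    the sum of the family, \<open>d\<close> agrees almost everywhere with \<open>D\<close>.\<close>
  define d where "d = (\<lambda>t. \<Omega> (fsum xs) t + (- 1) * (\<phi> ?\<theta> * fsum (map \<Omega> xs) t + of_real \<kappa> * G0 ?\<theta> t))"
  have int: "g w \<in> elts \<Sigma>" if "g \<in> \<H>" "w \<in> interior strip" for g w
    using calderonD(1)[OF that(1)] that(2) interior_subset by auto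
  have "has_deriv_into \<Sigma> K ?\<theta> d"
  proof -
    have dF: "has_deriv_into \<Sigma> F ?\<theta> (\<Omega> (fsum xs))"
      unfolding F_def by (rule \<Omega>'[OF fX])
    have dG0: "has_deriv_into \<Sigma> G0 ?\<theta> (fsum (map \<Omega> xs))"
      unfolding G0_def using B\<H> xsX by (intro calderon_deriv_fsum \<Omega>' \<theta>i) auto
    have "(\<phi> has_field_derivative of_real \<kappa>) (at ?\<theta>)"
      unfolding \<phi>_def by (auto intro!: derivative_eq_intros)
    from \<Sigma>.has_deriv_into_mult[OF dG0 int[OF G0\<H>] this open_interior \<theta>i]
    have dG: "has_deriv_into \<Sigma> G ?\<theta> (\<lambda>t. \<phi> ?\<theta> * fsum (map \<Omega> xs) t + of_real \<kappa> * G0 ?\<theta> t)"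
      by (simp add: G_def)
    have "has_deriv_into \<Sigma> (\<lambda>z t. (- 1) * G z t) ?\<theta>
       (\<lambda>t. (- 1) * (\<phi> ?\<theta> * fsum (map \<Omega> xs) t + of_real \<kappa> * G0 ?\<theta> t) + 0 * G ?\<theta> t)"
      by (rule \<Sigma>.has_deriv_into_mult[OF dG int[OF G\<H>] DERIV_const open_interior \<theta>i])
    then have dG': "has_deriv_into \<Sigma> (\<lambda>z t. (- 1) * G z t) ?\<theta>
       (\<lambda>t. (- 1) * (\<phi> ?\<theta> * fsum (map \<Omega> xs) t + of_real \<kappa> * G0 ?\<theta> t))"
      by simp
    show ?thesis unfolding K_def d_def
      by (intro \<Sigma>.has_deriv_into_add[OF dF int[OF F\<H>] dG' _ open_interior \<theta>i]
          \<Sigma>.scale_closed int[OF G\<H>])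
  qed
  note L\<H> = calderon_divide[OF K\<H> \<theta>i K\<theta> this]
  let ?L = "\<lambda>z. if z = ?\<theta> then d else (\<lambda>t. K z t / (z - ?\<theta>))"
  let ?\<delta> = "infdist ?\<theta> (frontier strip)"
  have \<delta>: "0 < ?\<delta>"
  proof (rule infdist_pos_not_in_closed)
    show "frontier strip \<noteq> {}" unfolding frontier_strip by (auto intro: exI[of _ 0])
    show "?\<theta> \<notin> frontier strip" using \<theta> by (simp add: frontier_strip)
  qed simp
  have \<delta>_le: "?\<delta> \<le> cmod (z - ?\<theta>)" if "z \<in> frontier strip" for z
    using infdist_le[OF that, of ?\<theta>] by (simp add: dist_norm norm_minus_commute)
  have L_le: "calderon_norm X0 X1 ?L \<le> 3 * (E / ?\<delta>)"
  proof (rule calderon_norm_le)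
    fix s
    have fr: "Complex 0 s \<in> frontier strip" "Complex 1 s \<in> frontier strip" by (auto simp: frontier_strip)
    have ne: "Complex 0 s \<noteq> ?\<theta>" "Complex 1 s \<noteq> ?\<theta>" using \<theta> by (auto simp: complex_eq_iff)
    have "nrm X0 (?L (Complex 0 s)) = nrm X0 (K (Complex 0 s)) / cmod (Complex 0 s - ?\<theta>)"
      using ne by (simp add: X0.nrm_divide calderonD(2)[OF K\<H>])
    also have "\<dots> \<le> 3 * E / ?\<delta>"
      using K_le0 E \<delta> \<delta>_le[OF fr(1)] by (intro frac_le) auto
    finally show "nrm X0 (?L (Complex 0 s)) \<le> 3 * (E / ?\<delta>)" by simp
    have "nrm X1 (?L (Complex 1 s)) = nrm X1 (K (Complex 1 s)) / cmod (Complex 1 s - ?\<theta>)"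
      using ne by (simp add: X1.nrm_divide calderonD(3)[OF K\<H>])
    also have "\<dots> \<le> 3 * E / ?\<delta>"
      using K_le1 E \<delta> \<delta>_le[OF fr(2)] by (intro frac_le) auto
    finally show "nrm X1 (?L (Complex 1 s)) \<le> 3 * (E / ?\<delta>)" by simp
  qed
  have D: "AE t in ?M. D t = ?L ?\<theta> t"
    using G0\<theta> by eventually_elim
      (simp add: D_def d_def \<phi>\<theta> \<kappa>_def \<Omega>_def fsum_def comp_def)
  show "nrm X D \<le> 3 * (E / ?\<delta>)"
    unfolding X_def by (rule interp_nrm_le[OF L\<H> D L_le])
  \<comment> \<open>Elements of the interpolation space must be measurable, and \<open>D\<close>
    equals the value of the quotient at \<theta> only almost everywhere, so measurability is shown
    directly.\<close>
  have "D \<in> borel_measurable ?M"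
  proof -
    have dm: "f \<in> borel_measurable ?M" if "f \<in> elts \<Sigma>" for f using that by (simp add: sum_space_def)
    have \<Omega>m: "\<Omega> x \<in> borel_measurable ?M" if "x \<in> elts X" for x
      using \<Omega>'[OF that] by (intro dm) (simp add: has_deriv_into_def)
    have fm: "fsum xs \<in> borel_measurable ?M" using fX by (simp add: X_def interp_def)
    have "fsum (map \<Omega> xs) \<in> elts \<Sigma>"
      using \<Omega>' xsX by (intro \<Sigma>.fsum_closed) (auto simp: has_deriv_into_def)
    from dm[OF this] have "(\<lambda>t. \<Sum>x\<leftarrow>xs. \<Omega> x t) \<in> borel_measurable ?M"
      by (simp add: fsum_def comp_def)
    then show ?thesis unfolding D_def using \<Omega>m[OF fX] fm unfolding \<Omega>_def by measurable
  qed
  then show "D \<in> elts X" unfolding X_def by (intro interp_memI[OF L\<H> _ D])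
qed

text \<open>
  If one of the two suprema vanishes, the logarithm in \<open>defect\<close> is the junk value 0. This is harmless:
  enlarging both suprema by a small \<open>h\<close> shows that the sum of the family has norm 0, so its coefficient
  does not matter.
\<close>

lemma defect_estimate:
  assumes \<theta>: "0 < \<theta>" "\<theta> < 1" and \<epsilon>: "0 < \<epsilon>" "\<epsilon> < 1 / 4"
    and S: "support_closed P S" and P: "\<And>X. P X \<Longrightarrow> kothe X" and PX: "P X0" "P X1"
    and B: "selector X0 X1 \<theta> \<epsilon> B"
    and xs: "(interp X0 X1 \<theta>, xs) \<in> S" "length xs = n" "\<forall>x\<in>set xs. nrm (interp X0 X1 \<theta>) x \<le> 1"
  defines "D \<equiv> defect S X0 X1 (centralizer X0 X1 \<theta> B) xs"
  shows "D \<in> elts (interp X0 X1 \<theta>) \<and> nrm (interp X0 X1 \<theta>) D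
    \<le> 3 * (M_sup S X0 n powr (1 - \<theta>) * M_sup S X1 n powr \<theta> / infdist (of_real \<theta>) (frontier strip))"
proof -
  define X where "X = interp X0 X1 \<theta>"
  define M0 M1 where "M0 = M_sup S X0 n" and "M1 = M_sup S X1 n"
  let ?\<delta> = "infdist (complex_of_real \<theta>) (frontier strip)"
  have PXi: "kothe X" and xsX: "set xs \<subseteq> elts X" using S xs(1) P by (auto simp: support_closed_def X_def)
  interpret X: seminormed_fspace X by (rule kothe_seminormed[OF PXi])
  have fX: "fsum xs \<in> elts X" by (rule X.fsum_closed[OF xsX])
  note bound = defect_bound[OF \<theta> \<epsilon> S P PX B xs(1,3), folded X_def, unfolded xs(2), folded M0_def M1_def]
  have "meas X1 = meas X0" using admissible by (simp add: admissible_couple_def)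
  then have "0 \<le> M_sup S Y n" if "P Y" "Y = X0 \<or> Y = X1" for Y
  proof -
    interpret Y: seminormed_fspace Y by (rule kothe_seminormed[OF P[OF that(1)]])
    \<comment> \<open>The zero family has empty supports and hence belongs to the class over
      \<open>Y\<close>; its sum has norm 0, a lower bound for the supremum.\<close>
    have "nrm Y (fsum (map (\<lambda>_ (_::'a). 0) xs)) \<le> 1 * M_sup S Y (length xs)"
      using that \<open>meas X1 = meas X0\<close>
      by (intro support_closed_bound[OF S P _ _ xs(1)]) (auto simp: Y.zero_closed Y.nrm_zero supp_le_def)
    moreover have "fsum (map (\<lambda>_ (_::'a). 0) xs) = (\<lambda>_. 0)" by (simp add: fsum_def comp_def)
    ultimately show ?thesis by (simp add: Y.nrm_zero xs(2))
  qed
  then have M: "0 \<le> M0" "0 \<le> M1" using PX by (auto simp: M0_def M1_def)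
  have D_def': "D = (\<lambda>t. centralizer X0 X1 \<theta> B (fsum xs) t - (\<Sum>x\<leftarrow>xs. centralizer X0 X1 \<theta> B x t)
     - of_real (ln (M0 / M1)) * fsum xs t)"
    by (simp add: D_def defect_def xs(2) M0_def M1_def)
  have "D \<in> elts X \<and> nrm X D \<le> 3 * (M0 powr (1 - \<theta>) * M1 powr \<theta> / ?\<delta>)"
  proof (cases "0 < M0 \<and> 0 < M1")
    case True
    then show ?thesis using bound(2,3)[of M0 M1] by (simp add: D_def')
  next
    case False
    define E where "E = (\<lambda>h. (M0 + h) powr (1 - \<theta>) * (M1 + h) powr \<theta>)"
    have E0: "M0 powr (1 - \<theta>) * M1 powr \<theta> = 0" using False M \<theta> by auto
    have nonneg: "\<forall>\<^sub>F h in at_right 0. 0 \<le> M0 + h" "\<forall>\<^sub>F h in at_right 0. 0 \<le> M1 + h"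
      using M by (auto simp: eventually_at_right_less intro: eventually_mono[OF eventually_at_right_less])
    \<comment> \<open>Both exponents are positive, so the powers are continuous up to base 0 when
      approached through nonnegative bases.\<close>
    have "(E \<longlongrightarrow> (M0 + 0) powr (1 - \<theta>) * (M1 + 0) powr \<theta>) (at_right 0)"
      unfolding E_def using \<theta> nonneg by (intro tendsto_intros) auto
    then have lim: "(E \<longlongrightarrow> 0) (at_right 0)" using E0 by simp
    have pos: "\<forall>\<^sub>F h in at_right (0::real). 0 < h" by (rule eventually_at_right_less)
    have "nrm X (fsum xs) \<le> 0"
    proof (rule tendsto_lowerbound)
      show "((\<lambda>h. (1 + \<epsilon>) * E h) \<longlongrightarrow> 0) (at_right 0)" using lim by (rule tendsto_mult_right_zero)
      show "\<forall>\<^sub>F h in at_right 0. nrm X (fsum xs) \<le> (1 + \<epsilon>) * E h"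
        using pos unfolding E_def by eventually_elim (rule bound(1); use M in simp)
    qed simp
    then have f0: "nrm X (fsum xs) = 0" using X.nrm_nonneg[OF fX] by simp
    have D_le: "D \<in> elts X \<and> nrm X D \<le> 3 * (E h / ?\<delta>)" if h: "0 < h" for h
    proof -
      let ?D' = "\<lambda>t. centralizer X0 X1 \<theta> B (fsum xs) t - (\<Sum>x\<leftarrow>xs. centralizer X0 X1 \<theta> B x t)
        - of_real (ln ((M0 + h) / (M1 + h))) * fsum xs t"
      define c where "c = complex_of_real (ln ((M0 + h) / (M1 + h)) - ln (M0 / M1))"
      have D': "?D' \<in> elts X" "nrm X ?D' \<le> 3 * (E h / ?\<delta>)"
        using bound(2,3)[of "M0 + h" "M1 + h"] M h by (auto simp: E_def)
      have "D = (\<lambda>t. ?D' t + c * fsum xs t)"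
        by (simp add: D_def' c_def fun_eq_iff algebra_simps)
      moreover have "nrm X (\<lambda>t. ?D' t + c * fsum xs t) \<le> nrm X ?D'"
        using X.nrm_add_le[OF D'(1) X.scale_closed[OF fX, of c]] X.nrm_scale[OF fX, of c] f0 by simp
      moreover have "(\<lambda>t. ?D' t + c * fsum xs t) \<in> elts X"
        by (intro X.add_closed X.scale_closed D' fX)
      ultimately show ?thesis using D'(2) by simp
    qed
    have "nrm X D \<le> 0"
    proof (rule tendsto_lowerbound)
      show "((\<lambda>h. 3 * (E h / ?\<delta>)) \<longlongrightarrow> 0) (at_right 0)"
        using lim by (intro tendsto_mult_right_zero tendsto_divide_zero)
      show "\<forall>\<^sub>F h in at_right 0. nrm X D \<le> 3 * (E h / ?\<delta>)"
        using pos by eventually_elim (use D_le in blast)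
    qed simp
    then show ?thesis unfolding E0 using D_le[of 1] by simp
  qed
  then show ?thesis by (simp add: X_def M0_def M1_def)
qed

end

theorem lemma4p5:
  fixes S :: "'a families" and T U :: "nat families"
    and X0 X1 :: "'a fspace" and Y0 Y1 :: "nat fspace"
    and \<theta> \<epsilon> :: real and n :: nat
  assumes "0 < \<theta>" and "\<theta> < 1" and "0 < \<epsilon>" and "\<epsilon> < 1 / 4"
  shows
    "(standard_class S T \<and> admissible_couple X0 X1 \<and> selector X0 X1 \<theta> \<epsilon> B \<and>
      (interp X0 X1 \<theta>, xs) \<in> S \<and> length xs = n \<and> (\<forall>x\<in>set xs. nrm (interp X0 X1 \<theta>) x \<le> 1) \<longrightarrow>
        defect S X0 X1 (centralizer X0 X1 \<theta> B) xs \<in> elts (interp X0 X1 \<theta>) \<and>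
        nrm (interp X0 X1 \<theta>) (defect S X0 X1 (centralizer X0 X1 \<theta> B) xs)
          \<le> 3 * (M_sup S X0 n powr (1 - \<theta>) * M_sup S X1 n powr \<theta>
                  / infdist (of_real \<theta>) (frontier strip)))
     \<and>
     (standard_basis_class U \<and> basis_space Y0 \<and> basis_space Y1 \<and> admissible_couple Y0 Y1 \<and>
      selector Y0 Y1 \<theta> \<epsilon> C \<and>
      (interp Y0 Y1 \<theta>, ys) \<in> U \<and> length ys = n \<and> (\<forall>y\<in>set ys. nrm (interp Y0 Y1 \<theta>) y \<le> 1) \<longrightarrow>
        defect U Y0 Y1 (centralizer Y0 Y1 \<theta> C) ys \<in> elts (interp Y0 Y1 \<theta>) \<and>
        nrm (interp Y0 Y1 \<theta>) (defect U Y0 Y1 (centralizer Y0 Y1 \<theta> C) ys)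
          \<le> 3 * (M_sup U Y0 n powr (1 - \<theta>) * M_sup U Y1 n powr \<theta>
                  / infdist (of_real \<theta>) (frontier strip)))"
proof (intro conjI[of "_ \<longrightarrow> _"] impI; elim conjE)
  assume "standard_class S T" and adm: "admissible_couple X0 X1" and sel: "selector X0 X1 \<theta> \<epsilon> B"
    and xs: "(interp X0 X1 \<theta>, xs) \<in> S" "length xs = n" "\<forall>x\<in>set xs. nrm (interp X0 X1 \<theta>) x \<le> 1"
  then have S: "support_closed kothe S" by (simp add: standard_class_def)
  have X: "kothe X0" "kothe X1" using adm by (auto simp: admissible_couple_def)
  interpret couple X0 X1 by (rule couple.intro[OF adm])
  show "defect S X0 X1 (centralizer X0 X1 \<theta> B) xs \<in> elts (interp X0 X1 \<theta>) \<and>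
    nrm (interp X0 X1 \<theta>) (defect S X0 X1 (centralizer X0 X1 \<theta> B) xs)
      \<le> 3 * (M_sup S X0 n powr (1 - \<theta>) * M_sup S X1 n powr \<theta> / infdist (of_real \<theta>) (frontier strip))"
    \<comment> \<open>Both halves are the same estimate: here the predicate \<open>P\<close> is
      \<open>kothe\<close>, below it is \<open>basis_space\<close>.\<close>
    by (rule defect_estimate[OF assms S _ X sel xs])
next
  assume "standard_basis_class U" and adm: "admissible_couple Y0 Y1" and sel: "selector Y0 Y1 \<theta> \<epsilon> C"
    and Y: "basis_space Y0" "basis_space Y1"
    and ys: "(interp Y0 Y1 \<theta>, ys) \<in> U" "length ys = n" "\<forall>y\<in>set ys. nrm (interp Y0 Y1 \<theta>) y \<le> 1"
  then have U: "support_closed basis_space U" by (simp add: standard_basis_class_def)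
  have P: "kothe Y" if "basis_space Y" for Y using that by (simp add: basis_space_def)
  interpret couple Y0 Y1 by (rule couple.intro[OF adm])
  show "defect U Y0 Y1 (centralizer Y0 Y1 \<theta> C) ys \<in> elts (interp Y0 Y1 \<theta>) \<and>
    nrm (interp Y0 Y1 \<theta>) (defect U Y0 Y1 (centralizer Y0 Y1 \<theta> C) ys)
      \<le> 3 * (M_sup U Y0 n powr (1 - \<theta>) * M_sup U Y1 n powr \<theta> / infdist (of_real \<theta>) (frontier strip))"
    by (rule defect_estimate[OF assms U P Y sel ys])
qed

end
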